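(* Let $d\ge 2$ be an integer and let $A,B,C\in\mathbb{Q}[z]$ be non-zero polynomials. Let $f(z)\in\mathbb{Q}((z^{-1}))$ satisfy $$f(z)=\frac{A(z)f(z^d)+C(z)}{B(z)}$$ and suppose that $f$ is not a rational function. Let $(p_k(z)/q_k(z))_{k\ge 0}$ be the sequence of convergents of $f$ and let $d_k=\deg(q_k(z))$. Let $b\in\mathbb{Z}$, $|b|\ge 2$, be inside the disc of convergence of $f$ and such that $A(b^{d^t})B(b^{d^t})\neq 0$ for all $t\in\mathbb{N}$. Then the irrationality exponent of $f(b)$ is $$\mu(f(b))=1+\limsup_{k\to\infty}\frac{d_{k+1}}{d_k}.$$
   Context: $\mathbb{N}=\{0,1,2,\dots\}$. For $\alpha\in\mathbb{R}$, the irrationality exponent $\mu(\alpha)$ is the supremum of the set of $\mu\in\mathbb{R}$ such that $|\alpha-p/q|<q^{-\mu}$ has infinitely many solutions in integers $p,q$ with $q\ge 1$ (it may be $\infty$). $\mathbb{Q}((z^{-1}))$ is the set of formal Laurent series $f(z)=\sum_{k=-n}^{\infty}c_kz^{-k}$ with $n\in\mathbb{Z}$, $c_k\in\mathbb{Q}$; $\deg f$ is the largest exponent of $z$ with non-zero coefficient. There is $\rho\in[0,\infty]$ such that $f(z)$ converges for complex $|z|>\rho$ and diverges for $|z|<\rho$; "$b$ is inside the disc of convergence of $f$" means $|b|>\rho$. Convergents: $\lfloor f\rfloor$ denotes the polynomial part of $f$. For $f$ not a rational function put $a_0=\lfloor f\rfloor$, $f_1=(f-a_0)^{-1}$, and for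 $n\ge1$ $a_n=\lfloor f_n\rfloor$, $f_{n+1}=(f_n-a_n)^{-1}$. Put $p_0=a_0$, $q_0=1$, $p_1=a_1a_0+1$, $q_1=a_1$, and $p_n=a_np_{n-1}+p_{n-2}$, $q_n=a_nq_{n-1}+q_{n-2}$ for $n\ge2$. The rational functions $p_n/q_n$ are the convergents of $f$; $p_n,q_n\in\mathbb{Q}[z]$ are coprime and $\deg q_n$ is strictly increasing. *)

theory Defs
  imports "HOL-Complex_Analysis.Complex_Analysis"
begin

unbundle Formal_Laurent_Series.fps_syntax

text \<open>
  A series \<open>f(z) = \<Sum>k\<ge>-n. c\<^sub>k z\<^sup>-\<^sup>k\<close> in \<open>\<rat>((z\<^sup>-\<^sup>1))\<close> is represented by the formal Laurent
  series of type \<open>rat fls\<close> in the indeterminate \<open>X = z\<^sup>-\<^sup>1\<close>: the coefficient \<open>c\<^sub>k\<close> of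
  \<open>z\<^sup>-\<^sup>k\<close> is \<open>f $$ k\<close>, the variable \<open>z\<close> is \<open>fls_X_inv\<close>, and \<open>f(z\<^sup>d)\<close> is
  \<open>fls_compose_power f d\<close>.
\<close>

definition fls_of_zpoly :: "'a::comm_ring_1 poly \<Rightarrow> 'a fls" where
  "fls_of_zpoly P = poly (map_poly fls_const P) fls_X_inv"

definition is_rational_function :: "rat fls \<Rightarrow> bool" where
  "is_rational_function f \<longleftrightarrow> (\<exists>P Q. Q \<noteq> 0 \<and> f = fls_of_zpoly P / fls_of_zpoly Q)"

text \<open>
  Since \<open>fls_prpart\<close> omits the constant term, it has to be added to obtain the polynomial part.
\<close>

definition fls_polypart :: "'a::comm_monoid_add fls \<Rightarrow> 'a poly" where
  "fls_polypart f = fls_prpart f + [:f $$ 0:]"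

lemma coeff_fls_polypart: "coeff (fls_polypart f) n = f $$ (- int n)"
  by (cases n) (simp_all add: fls_polypart_def)


text \<open>
  The complete quotients \<open>f\<^sub>n\<close> (with \<open>f\<^sub>0 = f\<close>), the partial quotients \<open>a\<^sub>n\<close>, and the
  convergents \<open>p\<^sub>n/q\<^sub>n\<close> of a series that is not a rational function.
\<close>

fun cf_complete :: "rat fls \<Rightarrow> nat \<Rightarrow> rat fls" where
  "cf_complete f 0 = f"
| "cf_complete f (Suc n) =
     inverse (cf_complete f n - fls_of_zpoly (fls_polypart (cf_complete f n)))"

definition cf_partial :: "rat fls \<Rightarrow> nat \<Rightarrow> rat poly" where
  "cf_partial f n = fls_polypart (cf_complete f n)"

fun cf_num :: "rat fls \<Rightarrow> nat \<Rightarrow> rat poly" where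
  "cf_num f 0 = cf_partial f 0"
| "cf_num f (Suc 0) = cf_partial f 1 * cf_partial f 0 + 1"
| "cf_num f (Suc (Suc n)) = cf_partial f (Suc (Suc n)) * cf_num f (Suc n) + cf_num f n"

fun cf_denom :: "rat fls \<Rightarrow> nat \<Rightarrow> rat poly" where
  "cf_denom f 0 = 1"
| "cf_denom f (Suc 0) = cf_partial f 1"
| "cf_denom f (Suc (Suc n)) = cf_partial f (Suc (Suc n)) * cf_denom f (Suc n) + cf_denom f n"


lift_definition complex_fls :: "rat fls \<Rightarrow> complex fls" is "\<lambda>f n. of_rat (f n)"
  by (auto elim: eventually_mono)

lemma complex_fls_nth [simp]: "complex_fls f $$ n = of_rat (f $$ n)"
  by transfer simp

text \<open>
  The library's \<open>fls_conv_radius\<close> is the radius of convergence in \<open>X = z\<^sup>-\<^sup>1\<close>; its inverse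
  (in the extended reals, with \<open>1/0 = \<infinity>\<close> and \<open>1/\<infinity> = 0\<close>) is the \<open>\<rho>\<close> such that \<open>f(z)\<close>
  converges for \<open>|z| > \<rho>\<close> and diverges for \<open>0 < |z| < \<rho>\<close>.
\<close>

definition conv_rho :: "rat fls \<Rightarrow> ereal" where
  "conv_rho f = inverse (fls_conv_radius (complex_fls f))"

text \<open>
  The value \<open>f(x)\<close> at a real point \<open>x\<close>, obtained by evaluating at \<open>X = x\<^sup>-\<^sup>1\<close>. The library
  evaluates complex series; \<open>of_real_fls_value\<close> below shows that taking the real part loses
  nothing.
\<close>

definition fls_value :: "rat fls \<Rightarrow> real \<Rightarrow> real" where
  "fls_value f x = Re (eval_fls (complex_fls f) (of_real (inverse x)))"

lemma conv_rho_less_iff: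
  assumes "x > 0"
  shows   "conv_rho f < ereal x \<longleftrightarrow> ereal (inverse x) < fls_conv_radius (complex_fls f)"
proof -
  have "fls_conv_radius (complex_fls f) \<ge> 0"
    by (simp add: fls_conv_radius_def fps_conv_radius_def conv_radius_nonneg)
  then show ?thesis
    using assms unfolding conv_rho_def
    by (cases "fls_conv_radius (complex_fls f)") (auto simp: field_simps)
qed

lemma fls_value_sums_complex:
  assumes "conv_rho f < ereal \<bar>x\<bar>" "x \<noteq> 0"
  shows   "(\<lambda>k. of_real (of_rat (f $$ (int k + fls_subdegree f)) *
                  x powi (- (int k + fls_subdegree f))))
             sums eval_fls (complex_fls f) (of_real (inverse x))"
proof -
  let ?F = "complex_fls f" and ?y = "of_real (inverse x) :: complex"
  have subdeg: "fls_subdegree ?F = fls_subdegree f"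
  proof (cases "f = 0")
    case True
    then have "?F = 0" by (intro fls_eqI) simp
    with True show ?thesis by simp
  next
    case False
    then show ?thesis by (intro fls_subdegree_eqI) auto
  qed
  have "ereal (norm ?y) < fls_conv_radius ?F"
    using conv_rho_less_iff[of "\<bar>x\<bar>" f] assms by (simp add: norm_inverse)
  then have "(\<lambda>k. fps_nth (fls_base_factor_to_fps ?F) k * ?y ^ k)
               sums eval_fps (fls_base_factor_to_fps ?F) ?y"
    by (intro sums_eval_fps) (simp add: fls_conv_radius_altdef)
  from sums_mult2[OF this, of "?y powi fls_subdegree ?F"]
  have "(\<lambda>k. fps_nth (fls_base_factor_to_fps ?F) k * ?y ^ k * ?y powi fls_subdegree ?F)
               sums eval_fls ?F ?y"
    by (simp add: eval_fls_def)
  also have "(\<lambda>k. fps_nth (fls_base_factor_to_fps ?F) k * ?y ^ k * ?y powi fls_subdegree ?F) =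
     (\<lambda>k. of_real (of_rat (f $$ (int k + fls_subdegree f)) *
            x powi (- (int k + fls_subdegree f))))"
  proof
    fix k
    have "?y ^ k * ?y powi fls_subdegree f = ?y powi (int k + fls_subdegree f)"
      using assms(2) by (subst power_int_add) auto
    also have "\<dots> = of_real (x powi (- (int k + fls_subdegree f)))"
      by (simp only: of_real_power_int of_real_inverse power_int_minus power_int_inverse)
    finally have *: "?y ^ k * ?y powi fls_subdegree f =
                       of_real (x powi (- (int k + fls_subdegree f)))" .
    have "of_rat r = complex_of_real (of_rat r)" for r
      by (cases r) (simp add: of_rat_rat)
    with * show "fps_nth (fls_base_factor_to_fps ?F) k * ?y ^ k * ?y powi fls_subdegree ?F =
        of_real (of_rat (f $$ (int k + fls_subdegree f)) * x powi (- (int k + fls_subdegree f)))"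
      by (simp add: subdeg mult.assoc)
  qed
  finally show ?thesis .
qed

lemma fls_value_sums:
  assumes "conv_rho f < ereal \<bar>x\<bar>" "x \<noteq> 0"
  shows   "(\<lambda>k. of_rat (f $$ (int k + fls_subdegree f)) * x powi (- (int k + fls_subdegree f)))
             sums fls_value f x"
  using sums_Re[OF fls_value_sums_complex[OF assms]] by (simp only: fls_value_def Re_complex_of_real)

lemma of_real_fls_value:
  assumes "conv_rho f < ereal \<bar>x\<bar>" "x \<noteq> 0"
  shows   "of_real (fls_value f x) = eval_fls (complex_fls f) (of_real (inverse x))"
  using fls_value_sums_complex[OF assms] fls_value_sums[OF assms, THEN sums_of_real]
  by (rule sums_unique2[symmetric])


text \<open>
  The pairs \<open>(p, q)\<close> are not required to be coprime, so the exponent of a rational number is \<open>\<infinity>\<close>.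
\<close>

definition irrationality_exponent :: "real \<Rightarrow> ereal" where
  "irrationality_exponent \<alpha> =
     Sup (ereal ` {\<mu>. infinite {(p :: int, q :: int). q \<ge> 1 \<and>
                          \<bar>\<alpha> - of_int p / of_int q\<bar> < of_int q powr (- \<mu>)}})"

end

theory Submission
  imports Defs
begin

text \<open>
  Iterating the functional equation gives
  \<open>B\<^sub>t(z) f(z) = A\<^sub>t(z) f(z\<^bsup>d^t\<^esup>) + C\<^sub>t(z)\<close> with \<open>A\<^sub>t(z) = \<Prod>i<t. A(z\<^bsup>d^i\<^esup>)\<close> and likewise for
  \<open>B\<^sub>t\<close>. Substituting the convergents \<open>p\<^sub>k/q\<^sub>k\<close> of \<open>f\<close> at \<open>y = b\<^bsup>d^t\<^esup>\<close> yields, up to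
  denominators, the integer pairs
  \<open>P = A\<^sub>t(b) p\<^sub>k(y) + C\<^sub>t(b) q\<^sub>k(y)\<close> and \<open>Q = B\<^sub>t(b) q\<^sub>k(y)\<close> with
  \<open>Q f(b) - P = A\<^sub>t(b) (q\<^sub>k f - p\<^sub>k)(y)\<close>. As \<open>q\<^sub>k f - p\<^sub>k\<close> has degree \<open>-d\<^sub>k\<^sub>+\<^sub>1\<close>, this gives
  \<open>log |Q| \<le> (d\<^sub>k + O(1)) d\<^sup>t log |b|\<close> and \<open>log |Q f(b) - P| \<le> (-d\<^sub>k\<^sub>+\<^sub>1 + O(1)) d\<^sup>t log |b|\<close>, where
  the bounded terms do not depend on \<open>k\<close>. Fixed large \<open>k\<close> and \<open>t \<rightarrow> \<infinity>\<close> give the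
  lower bound for the exponent. For the upper bound, \<open>p\<^sub>k\<^sub>+\<^sub>1 q\<^sub>k - p\<^sub>k q\<^sub>k\<^sub>+\<^sub>1 = \<plusminus>1\<close> and the
  non-vanishing of \<open>A\<^sub>t(b) B\<^sub>t(b)\<close> make the pairs for \<open>k\<close> and \<open>k + 1\<close> independent, so one of
  them differs from a given \<open>p/q\<close>, which is then badly approximated if \<open>k\<close> and \<open>t\<close> are chosen
  according to the size of \<open>q\<close>.
\<close>

subsection \<open>Irrationality exponents\<close>

text \<open>For rational \<open>\<alpha>\<close> all multiples of one representing pair are
  solutions, since pairs need not be coprime. Otherwise any finite set of solutions stays at
  positive distance from \<open>\<alpha>\<close>, and the hypothesis supplies a closer one.\<close>

lemma irrationality_exponent_geI:
  fixes \<alpha> \<mu> :: real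
  assumes "\<And>e. e > 0 \<Longrightarrow> \<exists>p q :: int. q \<ge> 1 \<and> \<bar>\<alpha> - of_int p / of_int q\<bar> < e
             \<and> \<bar>\<alpha> - of_int p / of_int q\<bar> < of_int q powr (- \<mu>)"
  shows "ereal \<mu> \<le> irrationality_exponent \<alpha>"
proof -
  define S where "S = {(p :: int, q :: int). q \<ge> 1 \<and>
                          \<bar>\<alpha> - of_int p / of_int q\<bar> < of_int q powr (- \<mu>)}"
  have "infinite S"
  proof (cases "\<exists>p q :: int. q \<ge> 1 \<and> \<alpha> = of_int p / of_int q")
    case True
    then obtain p q :: int where pq: "q \<ge> 1" "\<alpha> = of_int p / of_int q" by blast
    have "inj (\<lambda>n::nat. ((int n + 1) * p, (int n + 1) * q))"
      using pq by (auto simp: inj_on_def)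
    moreover have "range (\<lambda>n::nat. ((int n + 1) * p, (int n + 1) * q)) \<subseteq> S"
    proof safe
      fix n :: nat
      have "(int n + 1) * q \<ge> 1"
        using pq by (simp add: add_pos_nonneg int_one_le_iff_zero_less)
      moreover have "real_of_int ((int n + 1) * p) / of_int ((int n + 1) * q) = \<alpha>"
      proof -
        have "real_of_int (int n + 1) \<noteq> 0" by linarith
        then show ?thesis
          unfolding of_int_mult using pq by (subst mult_divide_mult_cancel_left) auto
      qed
      moreover have "real_of_int ((int n + 1) * q) \<noteq> 0" using pq by simp
      ultimately show "((int n + 1) * p, (int n + 1) * q) \<in> S" unfolding S_def by simp
    qed
    ultimately show ?thesis
      using finite_subset range_inj_infinite by blast
  next
    case False
    show ?thesis
    proof
      assume fin: "finite S"
      \<comment> \<open>The inserted 1 keeps the set non-empty, so \<open>Min\<close> is meaningful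
        even for empty \<open>S\<close>.\<close>
      define e where "e = Min (insert 1 ((\<lambda>(p, q). \<bar>\<alpha> - of_int p / of_int q\<bar>) ` S))"
      have "e > 0" unfolding e_def using fin False
        by (subst Min_gr_iff) (auto simp: S_def)
      with assms obtain p q :: int where pq: "q \<ge> 1" "\<bar>\<alpha> - of_int p / of_int q\<bar> < e"
          "\<bar>\<alpha> - of_int p / of_int q\<bar> < of_int q powr (- \<mu>)" by blast
      then have "(p, q) \<in> S" by (simp add: S_def)
      then have "e \<le> \<bar>\<alpha> - of_int p / of_int q\<bar>" unfolding e_def using fin
        by (intro Min_le) force+
      with pq show False by simp
    qed
  qed
  then show ?thesis
    unfolding irrationality_exponent_def S_def by (intro Sup_upper imageI) simp
qed

text \<open>Solutions with \<open>q\<close> below the threshold are finite in number, because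
  closeness to \<open>\<alpha>\<close> bounds the numerator by \<open>F q\<close> for each
  \<open>q\<close>.\<close>

lemma irrationality_exponent_leI:
  fixes \<alpha> L :: real
  assumes "\<And>\<mu>. \<mu> > L \<Longrightarrow> \<exists>N::int. \<forall>p q :: int. q \<ge> N \<longrightarrow> q \<ge> 1 \<longrightarrow>
             of_int q powr (- \<mu>) \<le> \<bar>\<alpha> - of_int p / of_int q\<bar>"
  shows "irrationality_exponent \<alpha> \<le> ereal L"
  unfolding irrationality_exponent_def
proof (intro Sup_least, clarify)
  fix \<mu> :: real
  assume inf: "infinite {(p :: int, q :: int). q \<ge> 1 \<and>
                 \<bar>\<alpha> - of_int p / of_int q\<bar> < of_int q powr (- \<mu>)}"
  have "\<mu> \<le> L"
  proof (rule ccontr)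
    assume "\<not> \<mu> \<le> L"
    with assms obtain N :: int where N: "\<And>p q :: int. q \<ge> N \<Longrightarrow> q \<ge> 1 \<Longrightarrow>
             of_int q powr (- \<mu>) \<le> \<bar>\<alpha> - of_int p / of_int q\<bar>" by (metis not_le)
    define F where "F = (\<lambda>q :: int. \<lceil>of_int q * (\<bar>\<alpha>\<bar> + of_int q powr (- \<mu>))\<rceil>)"
    have "{(p :: int, q :: int). q \<ge> 1 \<and> \<bar>\<alpha> - of_int p / of_int q\<bar> < of_int q powr (- \<mu>)}
        \<subseteq> (\<lambda>(q, p). (p, q)) ` (SIGMA q : {1..N}. {- F q .. F q})"
    proof clarify
      fix p q :: int
      assume q: "1 \<le> q" and less: "\<bar>\<alpha> - of_int p / of_int q\<bar> < of_int q powr (- \<mu>)"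
      have "q \<le> N" using N[of q p] q less by linarith
      have "\<bar>real_of_int p / of_int q\<bar> \<le> \<bar>\<alpha>\<bar> + of_int q powr (- \<mu>)" using less by linarith
      then have "\<bar>real_of_int p\<bar> \<le> of_int q * (\<bar>\<alpha>\<bar> + of_int q powr (- \<mu>))"
        using q by (simp add: abs_divide field_simps)
      then have "\<bar>p\<bar> \<le> F q" unfolding F_def by linarith
      with q \<open>q \<le> N\<close> show "(p, q) \<in> (\<lambda>(q, p). (p, q)) ` (SIGMA q : {1..N}. {- F q .. F q})"
        by force
    qed
    then have "finite {(p :: int, q :: int). q \<ge> 1 \<and>
                 \<bar>\<alpha> - of_int p / of_int q\<bar> < of_int q powr (- \<mu>)}"
      by (rule finite_subset) auto
    with inf show False by contradiction
  qed
  then show "ereal \<mu> \<le> ereal L" by simp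
qed

text \<open>
  Working with the linear forms \<open>Q \<alpha> - P\<close> instead of the fractions \<open>P / Q\<close> covers \<open>Q = 0\<close>.
\<close>

lemma linear_form_lower_bound:
  fixes \<alpha> H :: real and p q P Q P' Q' :: int
  assumes "q \<ge> 1" "P * Q' \<noteq> P' * Q"
    and "\<bar>of_int Q * \<alpha> - of_int P\<bar> \<le> 1 / (2 * of_int q)"
        "\<bar>of_int Q' * \<alpha> - of_int P'\<bar> \<le> 1 / (2 * of_int q)"
    and "\<bar>real_of_int Q\<bar> \<le> H" "\<bar>real_of_int Q'\<bar> \<le> H"
  shows "1 \<le> 2 * of_int q * H * \<bar>\<alpha> - of_int p / of_int q\<bar>"
proof -
  have *: "1 \<le> 2 * of_int q * H * \<bar>\<alpha> - of_int p / of_int q\<bar>"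
    if ne: "q * P \<noteq> p * Q" and le: "\<bar>of_int Q * \<alpha> - of_int P\<bar> \<le> 1 / (2 * of_int q)"
      "\<bar>real_of_int Q\<bar> \<le> H" for P Q :: int
  proof -
    \<comment> \<open>A non-zero integer has absolute value at least 1. It splits into a multiple of
      the error of \<open>p / q\<close> and a part of size at most 1/2, which is moved to the
      left.\<close>
    have "1 \<le> \<bar>q * P - p * Q\<bar>" using ne by linarith
    then have "1 \<le> \<bar>of_int q * of_int P - of_int p * real_of_int Q\<bar>"
      by (metis of_int_1_le_iff of_int_abs of_int_diff of_int_mult)
    also have "of_int q * of_int P - of_int p * real_of_int Q
       = of_int Q * (of_int q * (\<alpha> - of_int p / of_int q)) - of_int q * (of_int Q * \<alpha> - of_int P)"
      using assms(1) by (simp add: field_simps)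
    also have "\<bar>\<dots>\<bar> \<le> \<bar>of_int Q * (of_int q * (\<alpha> - of_int p / of_int q))\<bar>
        + \<bar>of_int q * (of_int Q * \<alpha> - of_int P)\<bar>" by (rule abs_triangle_ineq4)
    also have "\<bar>of_int q * (of_int Q * \<alpha> - of_int P)\<bar> \<le> 1 / 2"
      using le assms(1) by (simp only: abs_mult) (simp add: field_simps)
    also have "\<bar>of_int Q * (of_int q * (\<alpha> - of_int p / of_int q))\<bar>
        \<le> H * (of_int q * \<bar>\<alpha> - of_int p / of_int q\<bar>)"
      using le assms(1) by (simp add: abs_mult mult_right_mono)
    finally show ?thesis by (simp add: mult_ac)
  qed
  show ?thesis
  proof (cases "q * P = p * Q")
    case True
    \<comment> \<open>Two independent pairs cannot both be proportional to
      \<open>(p, q)\<close>.\<close>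
    have "q * P' \<noteq> p * Q'"
    proof
      assume "q * P' = p * Q'"
      with True have "q * (P * Q') = q * (P' * Q)"
        by (metis mult.assoc mult.commute)
      with assms(1,2) show False by simp
    qed
    then show ?thesis using * assms by blast
  next
    case False
    then show ?thesis using * assms by blast
  qed
qed

section \<open>Bracketing a real number and decay along lacunary exponents\<close>

lemma strict_mono_nat_bracket:
  fixes n :: "nat \<Rightarrow> nat" and x :: real
  assumes "strict_mono n" "real (n K) \<le> x"
  obtains k where "K \<le> k" "real (n k) \<le> x" "x < real (n (Suc k))"
proof -
  define k where "k = (GREATEST k. real (n k) \<le> x)"
  have bound: "k \<le> nat \<lceil>x\<rceil>" if "real (n k) \<le> x" for k
    using that strict_mono_imp_increasing[OF assms(1), of k] by linarith
  have "real (n k) \<le> x"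
    unfolding k_def by (rule GreatestI_nat[where P = "\<lambda>k. real (n k) \<le> x"])
      (use assms bound in auto)
  moreover have "k' \<le> k" if "real (n k') \<le> x" for k'
    unfolding k_def by (rule Greatest_le_nat[where P = "\<lambda>k. real (n k) \<le> x"])
      (use that bound in auto)
  ultimately show ?thesis
    using assms(2) that[of k] by (metis Suc_n_not_le_n not_le)
qed


lemma tendsto_powr_neg_power:
  fixes \<beta> \<delta> :: real and d :: nat
  assumes "\<beta> > 1" "d \<ge> 2" "\<delta> > 0"
  shows "(\<lambda>t. \<beta> powr (- \<delta> * real d ^ t)) \<longlonglongrightarrow> 0"
proof -
  have "filterlim (\<lambda>t. real d ^ t) at_top sequentially"
  proof (rule filterlim_at_top_mono[OF filterlim_real_sequentially], intro always_eventually allI)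
    show "real t \<le> real d ^ t" for t
      using assms less_exp[of t] power_mono[of 2 d t] by (metis less_imp_le of_nat_le_iff
          of_nat_power order_trans zero_le)
  qed
  moreover have "- \<delta> * ln \<beta> < 0"
    using assms by (simp add: mult_pos_pos)
  ultimately have "filterlim (\<lambda>t. (- \<delta> * ln \<beta>) * real d ^ t) at_bot sequentially"
    by (subst filterlim_tendsto_neg_mult_at_bot_iff[OF tendsto_const]) auto
  then have "((\<lambda>t. exp ((- \<delta> * ln \<beta>) * real d ^ t)) \<longlongrightarrow> 0) sequentially"
    by (rule filterlim_compose[OF exp_at_bot])
  then show ?thesis using assms by (simp add: powr_def mult_ac)
qed

text \<open>
  The loss \<open>a\<close> in the exponents is harmless because it does not grow with \<open>k\<close> while
  \<open>n k\<close> tends to infinity.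
\<close>

locale mahler_approximations =
  fixes n :: "nat \<Rightarrow> nat" and P Q :: "nat \<Rightarrow> nat \<Rightarrow> int" and d :: nat and \<alpha> \<beta> a :: real
  assumes n: "strict_mono n" and d: "d \<ge> 2" and \<beta>: "\<beta> > 1" and a: "a \<ge> 0"
    and Q_le: "\<And>k. \<forall>\<^sub>F t in sequentially.
                 \<bar>real_of_int (Q k t)\<bar> \<le> \<beta> powr ((a + real (n k)) * real d ^ t)"
    and error_le: "\<And>k. \<forall>\<^sub>F t in sequentially.
                 \<bar>of_int (Q k t) * \<alpha> - of_int (P k t)\<bar> \<le> \<beta> powr ((a - real (n (Suc k))) * real d ^ t)"
    and Q_nonzero: "\<And>k. \<forall>\<^sub>F t in sequentially. Q k t \<noteq> 0"
    and independent: "\<And>k. \<forall>\<^sub>F t in sequentially. P k t * Q (Suc k) t \<noteq> P (Suc k) t * Q k t"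
begin

definition L :: ereal where
  "L = limsup (\<lambda>k. ereal (real (n (Suc k)) / real (n k)))"

lemma n_ge: "k \<le> n k"
  using n by (rule strict_mono_imp_increasing)

lemma L_ge_1: "1 \<le> L"
proof -
  have "\<forall>\<^sub>F k in sequentially. 1 \<le> ereal (real (n (Suc k)) / real (n k))"
    \<comment> \<open>Index 0 is avoided because \<open>n 0\<close> may be 0, and the quotient is
      then 0 by convention.\<close>
    using eventually_ge_at_top[of 1]
  proof eventually_elim
    case (elim k)
    have "n k \<ge> 1" using n_ge[of k] elim by simp
    moreover have "n k \<le> n (Suc k)" using n by (simp add: strict_mono_less_eq)
    ultimately show ?case by (simp add: one_ereal_def)
  qed
  then show ?thesis unfolding L_def by (intro le_Limsup) auto
qed

text \<open>For \<open>s < r < L\<close> a single large index \<open>k\<close> with ratio above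
  \<open>r\<close> suffices: as \<open>t\<close> grows, the fractions \<open>P k t / Q k t\<close>
  approximate with exponent at least \<open>1 + s\<close>. The gap between \<open>s\<close> and
  \<open>r\<close> absorbs the loss \<open>a\<close>.\<close>

lemma irrationality_exponent_ge: "1 + L \<le> irrationality_exponent \<alpha>"
proof -
  have *: "ereal (1 + s) \<le> irrationality_exponent \<alpha>"
    if "0 < s" "s < r" "ereal r < L" for s r :: real
  proof (rule irrationality_exponent_geI)
    fix e :: real
    assume e: "e > 0"
    have freq: "\<exists>\<^sub>F k in sequentially. ereal r < ereal (real (n (Suc k)) / real (n k))"
    proof (rule ccontr)
      assume "\<not> ?thesis"
      then have "\<forall>\<^sub>F k in sequentially. ereal (real (n (Suc k)) / real (n k)) \<le> ereal r"
        unfolding not_frequently by eventually_elim simp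
      then have "L \<le> ereal r" unfolding L_def by (rule Limsup_bounded)
      with \<open>ereal r < L\<close> show False by simp
    qed
    \<comment> \<open>The quotient is what \<open>s * (a + n k) < n (Suc k) - a\<close> requires
      once \<open>n (Suc k) > r * n k\<close>; the added 1 makes \<open>n k\<close>
      positive.\<close>
    define M where "M = nat \<lceil>(a * (1 + s)) / (r - s)\<rceil> + 1"
    obtain k where k: "k \<ge> M" "r < real (n (Suc k)) / real (n k)"
      using frequently_eventually_frequently[OF freq eventually_ge_at_top[of M]]
      by (auto dest: frequently_ex)
    have nk: "real (n k) > 0" "real (n k) \<ge> (a * (1 + s)) / (r - s)"
      using n_ge[of k] k unfolding M_def by linarith+
    define \<delta> where "\<delta> = real (n (Suc k)) - a"
    have "s * (a + real (n k)) < \<delta>"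
    proof -
      have "(r - s) * real (n k) \<ge> a * (1 + s)"
        using nk(2) that by (simp add: field_simps)
      moreover have "r * real (n k) < real (n (Suc k))"
        using k(2) nk(1) by (simp add: field_simps)
      ultimately show ?thesis unfolding \<delta>_def by (simp add: algebra_simps)
    qed
    moreover have "s * (a + real (n k)) \<ge> 0" using that a by simp
    ultimately have \<delta>: "s * (a + real (n k)) < \<delta>" "\<delta> > 0" by linarith+
    have "\<forall>\<^sub>F t in sequentially. \<beta> powr (- \<delta> * real d ^ t) < e"
      using tendsto_powr_neg_power[OF \<beta> d \<delta>(2)] e by (rule order_tendstoD)
    then have "\<forall>\<^sub>F t in sequentially. \<beta> powr (- \<delta> * real d ^ t) < e \<and>
        \<bar>real_of_int (Q k t)\<bar> \<le> \<beta> powr ((a + real (n k)) * real d ^ t) \<and>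
        \<bar>of_int (Q k t) * \<alpha> - of_int (P k t)\<bar> \<le> \<beta> powr ((a - real (n (Suc k))) * real d ^ t) \<and>
        Q k t \<noteq> 0"
      by (intro eventually_conj Q_le error_le Q_nonzero)
    then obtain t where t: "\<beta> powr (- \<delta> * real d ^ t) < e"
        "\<bar>real_of_int (Q k t)\<bar> \<le> \<beta> powr ((a + real (n k)) * real d ^ t)"
        "\<bar>of_int (Q k t) * \<alpha> - of_int (P k t)\<bar> \<le> \<beta> powr ((a - real (n (Suc k))) * real d ^ t)"
        "Q k t \<noteq> 0"
      by (auto dest: eventually_happens)
    \<comment> \<open>The sign of \<open>Q k t\<close> is moved to the numerator to get a positive
      denominator.\<close>
    define q where "q = \<bar>Q k t\<bar>"
    define p where "p = sgn (Q k t) * P k t"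
    have q: "q \<ge> 1" using t(4) unfolding q_def by linarith
    have eq: "\<bar>\<alpha> - of_int p / of_int q\<bar> = \<bar>of_int (Q k t) * \<alpha> - of_int (P k t)\<bar> / of_int q"
      using t(4) by (auto simp: p_def q_def sgn_if abs_if field_simps)
    also have "\<dots> \<le> \<beta> powr (- \<delta> * real d ^ t) / of_int q"
      using t(3) q by (intro divide_right_mono) (simp_all add: \<delta>_def)
    finally have le: "\<bar>\<alpha> - of_int p / of_int q\<bar> \<le> \<beta> powr (- \<delta> * real d ^ t) / of_int q" .
    also have "\<dots> \<le> \<beta> powr (- \<delta> * real d ^ t)"
      using q divide_left_mono[of 1 "real_of_int q" "\<beta> powr (- \<delta> * real d ^ t)"] by simp
    also have "\<dots> < e" by (rule t(1))
    finally have small: "\<bar>\<alpha> - of_int p / of_int q\<bar> < e" .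
    have "\<beta> powr (- \<delta> * real d ^ t) < \<beta> powr (- s * ((a + real (n k)) * real d ^ t))"
    proof (rule powr_less_mono)
      have "(s * (a + real (n k))) * real d ^ t < \<delta> * real d ^ t"
        using \<delta>(1) d by (intro mult_strict_right_mono) auto
      then show "- \<delta> * real d ^ t < - s * ((a + real (n k)) * real d ^ t)"
        by (simp add: mult_ac)
    qed (use \<beta> in auto)
    also have "\<dots> = (\<beta> powr ((a + real (n k)) * real d ^ t)) powr (- s)"
      by (simp add: powr_powr mult_ac)
    also have "\<dots> \<le> of_int q powr (- s)"
      using t(2) q that by (intro powr_mono2') (auto simp: q_def)
    finally have "\<beta> powr (- \<delta> * real d ^ t) / of_int q < of_int q powr (- s) / of_int q"
      using q by (intro divide_strict_right_mono) auto
    \<comment> \<open>The summand 1 in the exponent comes from dividing the linear form by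
      \<open>q\<close>.\<close>
    also have "\<dots> = of_int q powr (- (1 + s))"
    proof -
      have "- (1 + s) = - s - 1" by simp
      then show ?thesis using q by (simp only: powr_diff) simp
    qed
    finally have "\<bar>\<alpha> - of_int p / of_int q\<bar> < of_int q powr (- (1 + s))" using le by linarith
    with q small show "\<exists>p q :: int. q \<ge> 1 \<and> \<bar>\<alpha> - of_int p / of_int q\<bar> < e
             \<and> \<bar>\<alpha> - of_int p / of_int q\<bar> < of_int q powr (- (1 + s))" by blast
  qed
  \<comment> \<open>\<open>L\<close> may be infinite, so it is approached from below;
    \<open>max y 0\<close> supplies the positivity of \<open>s\<close> that \<open>*\<close>
    demands.\<close>
  have "L \<le> irrationality_exponent \<alpha> - 1"
  proof (rule dense_le)
    fix y assume "y < L"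
    moreover have "0 < L" using L_ge_1 by (rule less_le_trans[rotated]) simp
    ultimately have "max y 0 < L" by simp
    then obtain s where s: "max y 0 < ereal s" "ereal s < L" using ereal_dense2 by blast
    then obtain r where r: "ereal s < ereal r" "ereal r < L" using ereal_dense2 by blast
    have "ereal (1 + s) \<le> irrationality_exponent \<alpha>" using * s r by auto
    then have "ereal s \<le> irrationality_exponent \<alpha> - 1"
      by (cases "irrationality_exponent \<alpha>") (auto simp: one_ereal_def)
    with s(1) show "y \<le> irrationality_exponent \<alpha> - 1" by (auto intro: order_trans less_imp_le)
  qed
  then show ?thesis
    by (cases "irrationality_exponent \<alpha>"; cases L) (auto simp: one_ereal_def)
qed

text \<open>Only finite \<open>L\<close> needs an argument: \<open>L_ge_1\<close> excludes minus
  infinity, and plus infinity is trivial. Two independent pairs of comparable size then bound the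
  distance of every \<open>p / q\<close> from \<open>\<alpha>\<close>.\<close>

lemma irrationality_exponent_le: "irrationality_exponent \<alpha> \<le> 1 + L"
proof (cases L)
  case (real l)
  have l: "l \<ge> 1" using L_ge_1 real by simp
  have "irrationality_exponent \<alpha> \<le> ereal (1 + l)"
  proof (rule irrationality_exponent_leI)
    fix \<mu> :: real
    assume \<mu>: "1 + l < \<mu>"
    \<comment> \<open>Given \<open>q\<close> and \<open>x = log \<beta> (2 q)\<close>, the scale \<open>t\<close> and then the index \<open>k\<close> are chosen with
      \<open>(n k - a) d\<^sup>t \<le> x < (n (k + 1) - a) d\<^sup>t\<close>. Here \<open>k\<close> stays bounded, so that the
      hypotheses hold uniformly in \<open>k\<close> once \<open>t\<close> is large.\<close>
    define \<eta> where "\<eta> = (\<mu> - 1 - l) / 3"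
    have \<eta>: "\<eta> > 0" using \<mu> by (simp add: \<eta>_def)
    define l' where "l' = l + \<eta>"
    have "L < ereal l'" using real \<eta> by (simp add: l'_def)
    then have "\<forall>\<^sub>F k in sequentially. ereal (real (n (Suc k)) / real (n k)) < ereal l'"
      unfolding L_def by (rule Limsup_lessD)
    then obtain K0 where K0: "\<And>k. k \<ge> K0 \<Longrightarrow> real (n (Suc k)) / real (n k) < l'"
      unfolding eventually_sequentially by auto
    \<comment> \<open>From \<open>K\<close> on, the ratios are below \<open>l'\<close> and the loss
      satisfies \<open>a + l' * a \<le> \<eta> * (n k - a)\<close>.\<close>
    define K where "K = max K0 (nat \<lceil>a + (a + l' * a) / \<eta>\<rceil> + 1)"
    have nK: "n K > 0" "real (n K) > a + (a + l' * a) / \<eta>"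
      using n_ge[of K] unfolding K_def by linarith+
    have "a + (a + l' * a) / \<eta> \<ge> a" using a \<eta> l by (simp add: l'_def)
    with nK have nKa: "real (n K) > a" by linarith
    have nSuc: "real (n (Suc k)) \<le> l' * real (n k)"
         "a + l' * a \<le> \<eta> * (real (n k) - a)" if "k \<ge> K" for k
    proof -
      have ge: "n K \<le> n k" using that n by (simp add: strict_mono_less_eq)
      with nK have "n k > 0" by linarith
      moreover have "real (n (Suc k)) / real (n k) < l'" using K0 that by (simp add: K_def)
      ultimately show "real (n (Suc k)) \<le> l' * real (n k)" by (simp add: field_simps)
      have "(a + l' * a) / \<eta> \<le> real (n k) - a" using nK(2) ge by linarith
      then show "a + l' * a \<le> \<eta> * (real (n k) - a)" using \<eta> by (simp add: field_simps)
    qed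
    \<comment> \<open>Maximality of the scale \<open>t\<close> chosen below gives
      \<open>x < d * (n K - a) * d^t\<close>, so the index \<open>k\<close> satisfies
      \<open>k \<le> n k \<le> M\<close>. Hence one threshold \<open>T\<close> serves every index
      that can occur, including \<open>Suc k\<close>.\<close>
    define M where "M = nat \<lceil>a + real d * (real (n K) - a)\<rceil>"
    have "\<forall>\<^sub>F t in sequentially. \<forall>k\<in>{..Suc M}.
        \<bar>real_of_int (Q k t)\<bar> \<le> \<beta> powr ((a + real (n k)) * real d ^ t) \<and>
        \<bar>of_int (Q k t) * \<alpha> - of_int (P k t)\<bar> \<le> \<beta> powr ((a - real (n (Suc k))) * real d ^ t) \<and>
        P k t * Q (Suc k) t \<noteq> P (Suc k) t * Q k t"
      by (intro eventually_ball_finite ballI eventually_conj Q_le error_le independent) auto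
    then obtain T where T: "\<And>t k. t \<ge> T \<Longrightarrow> k \<le> Suc M \<Longrightarrow>
        \<bar>real_of_int (Q k t)\<bar> \<le> \<beta> powr ((a + real (n k)) * real d ^ t)"
        "\<And>t k. t \<ge> T \<Longrightarrow> k \<le> Suc M \<Longrightarrow>
        \<bar>of_int (Q k t) * \<alpha> - of_int (P k t)\<bar> \<le> \<beta> powr ((a - real (n (Suc k))) * real d ^ t)"
        "\<And>t k. t \<ge> T \<Longrightarrow> k \<le> Suc M \<Longrightarrow> P k t * Q (Suc k) t \<noteq> P (Suc k) t * Q k t"
      unfolding eventually_sequentially by fastforce
    \<comment> \<open>The first entry forces \<open>t \<ge> T\<close>; the second gives
      \<open>\<mu> * log \<beta> 2 \<le> \<eta> * x\<close>.\<close>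
    define X where "X = max ((real (n K) - a) * real d ^ T) (\<mu> * log \<beta> 2 / \<eta>)"
    define N where "N = \<lceil>\<beta> powr X\<rceil>"
    show "\<exists>N::int. \<forall>p q :: int. q \<ge> N \<longrightarrow> q \<ge> 1 \<longrightarrow>
             of_int q powr (- \<mu>) \<le> \<bar>\<alpha> - of_int p / of_int q\<bar>"
    proof (intro exI[of _ N] allI impI)
      fix p q :: int
      assume q: "N \<le> q" "1 \<le> q"
      define x where "x = log \<beta> (2 * of_int q)"
      have x: "\<beta> powr x = 2 * of_int q" "\<beta> powr (- x) = 1 / (2 * of_int q)"
        using q \<beta> by (simp_all add: x_def powr_minus_divide)
      have "\<beta> powr X \<le> \<beta> powr x" using q unfolding x N_def by linarith
      then have X: "X \<le> x" using \<beta> by simp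
      have logq: "log \<beta> (of_int q) = x - log \<beta> 2"
        using q \<beta> by (simp add: x_def log_mult)
      have x_pos: "x > 0" unfolding x_def using q \<beta> by simp
      define t where "t = (GREATEST t. (real (n K) - a) * real d ^ t \<le> x)"
      have bnd: "t \<le> nat \<lceil>x / (real (n K) - a)\<rceil>" if "(real (n K) - a) * real d ^ t \<le> x" for t
      proof -
        have "real t \<le> real d ^ t"
          using self_le_power[of d t] d by (metis less_imp_le less_exp of_nat_le_iff of_nat_power
             order_trans power_mono zero_le)
        also have "\<dots> \<le> x / (real (n K) - a)" using that nKa by (simp add: field_simps)
        finally show ?thesis by linarith
      qed
      have base: "(real (n K) - a) * real d ^ T \<le> x" using X unfolding X_def by linarith
      have t: "(real (n K) - a) * real d ^ t \<le> x"
        unfolding t_def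
        by (rule GreatestI_nat[where P = "\<lambda>t. (real (n K) - a) * real d ^ t \<le> x"])
           (use base bnd in blast)+
      have "t \<ge> T"
        unfolding t_def
        by (rule Greatest_le_nat[where P = "\<lambda>t. (real (n K) - a) * real d ^ t \<le> x"])
           (use base bnd in blast)+
      have t': "x < (real (n K) - a) * real d ^ Suc t"
      proof (rule ccontr)
        assume "\<not> ?thesis"
        then have "Suc t \<le> t" unfolding t_def
          by (intro Greatest_le_nat[where P = "\<lambda>t. (real (n K) - a) * real d ^ t \<le> x"])
             (use bnd in auto)
        then show False by simp
      qed
      have dt: "real d ^ t > 0" using d by simp
      have "real (n K) \<le> a + x / real d ^ t" using t dt by (simp add: field_simps)
      with n obtain k where k: "K \<le> k" "real (n k) \<le> a + x / real d ^ t"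
          "a + x / real d ^ t < real (n (Suc k))"
        by (rule strict_mono_nat_bracket)
      have kx: "(real (n k) - a) * real d ^ t \<le> x" "x \<le> (real (n (Suc k)) - a) * real d ^ t"
        using k dt by (simp_all add: field_simps)
      have "x / real d ^ t < real d * (real (n K) - a)" using t' dt by (simp add: field_simps)
      then have "n k \<le> M" unfolding M_def using k(2) by linarith
      with n_ge[of k] have kM: "k \<le> M" by linarith
      define H where "H = \<beta> powr ((a + real (n (Suc k))) * real d ^ t)"
      have mono: "n k \<le> n (Suc k)" "n (Suc k) \<le> n (Suc (Suc k))"
        using n by (simp_all add: strict_mono_less_eq)
      have "1 \<le> 2 * of_int q * H * \<bar>\<alpha> - of_int p / of_int q\<bar>"
      proof (rule linear_form_lower_bound)
        \<comment> \<open>The upper bound on \<open>x\<close> brings the errors of both pairs below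
          \<open>\<beta> powr (- x)\<close>, which is \<open>1 / (2 * q)\<close>.\<close>
        have err: "\<beta> powr ((a - real m) * real d ^ t) \<le> 1 / (2 * of_int q)" if "m \<ge> n (Suc k)" for m
        proof -
          have "(real (n (Suc k)) - a) * real d ^ t \<le> (real m - a) * real d ^ t"
            using that dt by (intro mult_right_mono) auto
          with kx(2) have "x \<le> (real m - a) * real d ^ t" by linarith
          then have "(a - real m) * real d ^ t \<le> - x" by (simp add: algebra_simps)
          then show ?thesis using \<beta> unfolding x(2)[symmetric] by (intro powr_mono) auto
        qed
        show "\<bar>of_int (Q k t) * \<alpha> - of_int (P k t)\<bar> \<le> 1 / (2 * of_int q)"
          using T(2)[OF \<open>t \<ge> T\<close>, of k] kM err[of "n (Suc k)"] by simp
        show "\<bar>of_int (Q (Suc k) t) * \<alpha> - of_int (P (Suc k) t)\<bar> \<le> 1 / (2 * of_int q)"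
          using T(2)[OF \<open>t \<ge> T\<close>, of "Suc k"] kM err[of "n (Suc (Suc k))"] mono by simp
        have "\<beta> powr ((a + real (n k)) * real d ^ t) \<le> H"
          unfolding H_def using mono \<beta> dt by (intro powr_mono mult_right_mono) auto
        then show "\<bar>real_of_int (Q k t)\<bar> \<le> H"
          using T(1)[OF \<open>t \<ge> T\<close>, of k] kM by simp
        show "\<bar>real_of_int (Q (Suc k) t)\<bar> \<le> H"
          using T(1)[OF \<open>t \<ge> T\<close>, of "Suc k"] kM by (simp add: H_def)
      qed (use q T(3)[OF \<open>t \<ge> T\<close>, of k] kM in auto)
      also have "2 * of_int q * H = \<beta> powr (x + (a + real (n (Suc k))) * real d ^ t)"
        unfolding H_def powr_add x ..
      also have "\<dots> \<le> \<beta> powr (\<mu> * log \<beta> (of_int q))"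
      proof (rule powr_mono)
        \<comment> \<open>The ratio bound replaces \<open>n (Suc k)\<close> by
          \<open>l' * n k\<close>, and the lower bracket turns \<open>n k\<close> back into
          \<open>x\<close>. The coefficient \<open>\<eta> + l'\<close> equals
          \<open>\<mu> - 1 - \<eta>\<close>, which leaves \<open>\<eta> * x\<close> to
          spare.\<close>
        have "(a + real (n (Suc k))) * real d ^ t \<le> (a + l' * real (n k)) * real d ^ t"
          using nSuc[OF k(1)] dt by (intro mult_right_mono) auto
        also have "\<dots> = (a + l' * a) * real d ^ t + l' * ((real (n k) - a) * real d ^ t)"
          by (simp add: algebra_simps)
        also have "\<dots> \<le> \<eta> * (real (n k) - a) * real d ^ t + l' * ((real (n k) - a) * real d ^ t)"
          using nSuc[OF k(1)] dt by (intro add_right_mono mult_right_mono) auto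
        also have "\<dots> = (\<eta> + l') * ((real (n k) - a) * real d ^ t)"
          by (simp add: algebra_simps)
        also have "\<dots> \<le> (\<eta> + l') * x"
          using kx(1) \<eta> l by (intro mult_left_mono) (auto simp: l'_def)
        also have "\<dots> = \<mu> * x - \<eta> * x - x" by (simp add: l'_def \<eta>_def field_simps)
        finally have "x + (a + real (n (Suc k))) * real d ^ t \<le> \<mu> * x - \<eta> * x" by simp
        moreover have "\<eta> * x \<ge> \<mu> * log \<beta> 2"
        proof -
          have "\<mu> * log \<beta> 2 / \<eta> \<le> x" using X unfolding X_def by linarith
          then show ?thesis using \<eta> by (simp add: field_simps)
        qed
        ultimately show "x + (a + real (n (Suc k))) * real d ^ t \<le> \<mu> * log \<beta> (of_int q)"
          unfolding logq by (simp add: algebra_simps)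
      qed (use \<beta> in auto)
      also have "\<beta> powr (\<mu> * log \<beta> (of_int q)) = of_int q powr \<mu>"
        using q \<beta> by (simp add: mult.commute[of \<mu>] flip: powr_powr)
      finally have "1 \<le> of_int q powr \<mu> * \<bar>\<alpha> - of_int p / of_int q\<bar>"
        by (simp add: mult_right_mono)
      then show "of_int q powr (- \<mu>) \<le> \<bar>\<alpha> - of_int p / of_int q\<bar>"
        using q by (simp add: powr_minus field_simps)
    qed
  qed
  then show ?thesis using real by (simp add: one_ereal_def)
qed (use L_ge_1 in auto)

lemma irrationality_exponent_eq:
  "irrationality_exponent \<alpha> = 1 + limsup (\<lambda>k. ereal (real (n (Suc k)) / real (n k)))"
  using irrationality_exponent_ge irrationality_exponent_le unfolding L_def by (rule order_antisym[rotated])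

end

subsection \<open>Continued fractions of Laurent series\<close>

lemma fls_of_zpoly_0 [simp]: "fls_of_zpoly 0 = 0"
  and fls_of_zpoly_1 [simp]: "fls_of_zpoly (1 :: 'a :: comm_ring_1 poly) = 1"
  by (simp_all add: fls_of_zpoly_def)

lemma fls_of_zpoly_pCons:
  "fls_of_zpoly (pCons a P) = fls_const a + fls_X_inv * fls_of_zpoly P"
  by (simp add: fls_of_zpoly_def map_poly_pCons)

lemma fls_nth_fls_of_zpoly:
  "fls_of_zpoly P $$ k = (if k \<le> 0 then coeff P (nat (- k)) else 0)"
proof (induction P arbitrary: k)
  case (pCons a P)
  show ?case
  proof (cases "k < 0")
    case True
    then have "nat (- k) = Suc (nat (- (k + 1)))" by simp
    then show ?thesis using True
      by (simp add: fls_of_zpoly_pCons pCons.IH fls_X_inv_times_conv_shift)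
  next
    case False
    then show ?thesis
      by (simp add: fls_of_zpoly_pCons pCons.IH fls_X_inv_times_conv_shift)
  qed
qed simp

lemma fls_of_zpoly_add: "fls_of_zpoly (P + Q) = fls_of_zpoly P + fls_of_zpoly Q"
  by (intro fls_eqI) (simp add: fls_nth_fls_of_zpoly)

lemma fls_of_zpoly_smult: "fls_of_zpoly (smult c P) = fls_const c * fls_of_zpoly P"
  by (intro fls_eqI) (simp add: fls_nth_fls_of_zpoly)

lemma fls_of_zpoly_mult: "fls_of_zpoly (P * Q) = fls_of_zpoly P * fls_of_zpoly Q"
  by (induction P)
     (simp_all add: fls_of_zpoly_pCons fls_of_zpoly_add fls_of_zpoly_smult algebra_simps)

lemma fls_of_zpoly_eq_0_iff [simp]: "fls_of_zpoly P = 0 \<longleftrightarrow> P = 0"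
proof
  assume *: "fls_of_zpoly P = 0"
  show "P = 0"
  proof (rule poly_eqI)
    fix n
    have "coeff P n = fls_of_zpoly P $$ (- int n)" by (simp add: fls_nth_fls_of_zpoly)
    with * show "coeff P n = coeff 0 n" by simp
  qed
qed simp

lemma fls_subdegree_minus_polypart:
  assumes "g - fls_of_zpoly (fls_polypart g) \<noteq> 0"
  shows "fls_subdegree (g - fls_of_zpoly (fls_polypart g)) > 0"
proof -
  have "(g - fls_of_zpoly (fls_polypart g)) $$ k = 0" if "k < 1" for k
    using that by (simp add: fls_nth_fls_of_zpoly coeff_fls_polypart)
  with assms have "1 \<le> fls_subdegree (g - fls_of_zpoly (fls_polypart g))"
    by (intro fls_subdegree_geI) auto
  then show ?thesis by simp
qed

lemma degree_fls_polypart: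
  assumes "fls_subdegree g < 0"
  shows "degree (fls_polypart g) = nat (- fls_subdegree g)"
  using assms unfolding fls_polypart_def
  by (subst degree_add_eq_left) auto

text \<open>The classical determinant identity: one step of the recurrence only changes the sign.
  Its non-vanishing at every point later makes consecutive integer pairs independent.\<close>

lemma cf_num_denom_det:
  "cf_num f (Suc k) * cf_denom f k - cf_num f k * cf_denom f (Suc k) = (- 1) ^ k"
proof (induction k)
  case (Suc k)
  have "cf_num f (Suc (Suc k)) * cf_denom f (Suc k) - cf_num f (Suc k) * cf_denom f (Suc (Suc k))
      = - (cf_num f (Suc k) * cf_denom f k - cf_num f k * cf_denom f (Suc k))"
    by (simp add: algebra_simps)
  with Suc show ?case by simp
qed (simp add: algebra_simps)

definition cf_frac :: "rat fls \<Rightarrow> nat \<Rightarrow> rat fls" where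
  "cf_frac f k = cf_complete f k - fls_of_zpoly (cf_partial f k)"

definition cf_error :: "rat fls \<Rightarrow> nat \<Rightarrow> rat fls" where
  "cf_error f k = fls_of_zpoly (cf_denom f k) * f - fls_of_zpoly (cf_num f k)"

lemma cf_complete_Suc: "cf_complete f (Suc k) = inverse (cf_frac f k)"
  by (simp add: cf_frac_def cf_partial_def)

lemma cf_error_nonzero:
  assumes "\<not> is_rational_function f" "cf_denom f k \<noteq> 0"
  shows "cf_error f k \<noteq> 0"
proof
  assume "cf_error f k = 0"
  then have "f = fls_of_zpoly (cf_num f k) / fls_of_zpoly (cf_denom f k)"
    using assms(2) by (simp add: cf_error_def field_simps)
  with assms show False unfolding is_rational_function_def by blast
qed

text \<open>A fractional part has positive order in \<open>X\<close>; inversion turns it into a pole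
  of the same order, which is the degree of the next polynomial part.\<close>

lemma degree_cf_partial_Suc:
  assumes "cf_frac f k \<noteq> 0"
  shows "int (degree (cf_partial f (Suc k))) = fls_subdegree (cf_frac f k)"
    and "degree (cf_partial f (Suc k)) > 0"
proof -
  have "fls_subdegree (cf_frac f k) > 0"
    using assms fls_subdegree_minus_polypart unfolding cf_frac_def cf_partial_def by blast
  moreover have "fls_subdegree (cf_complete f (Suc k)) = - fls_subdegree (cf_frac f k)"
    unfolding cf_complete_Suc using assms by (simp add: fls_inverse_subdegree)
  ultimately have "degree (cf_partial f (Suc k)) = nat (fls_subdegree (cf_frac f k))"
    "fls_subdegree (cf_frac f k) > 0"
    using degree_fls_polypart[of "cf_complete f (Suc k)"] unfolding cf_partial_def by simp_all
  then show "int (degree (cf_partial f (Suc k))) = fls_subdegree (cf_frac f k)"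
    and "degree (cf_partial f (Suc k)) > 0" by simp_all
qed

text \<open>
  All complete quotients are well-defined (\<open>inverse 0 = 0\<close> never occurs), because a vanishing
  \<open>cf_frac f (Suc k)\<close> would make the error of a convergent vanish.
\<close>

lemma cf_step:
  assumes "\<not> is_rational_function f"
  shows "cf_frac f k \<noteq> 0 \<and> cf_denom f k \<noteq> 0
    \<and> degree (cf_denom f (Suc k)) = degree (cf_partial f (Suc k)) + degree (cf_denom f k)
    \<and> cf_error f (Suc k) = - cf_error f k * cf_frac f (Suc k)"
proof (induction k)
  case 0
  have "cf_error f 0 = cf_frac f 0" by (simp add: cf_error_def cf_frac_def)
  with cf_error_nonzero[OF assms, of 0] have nz: "cf_frac f 0 \<noteq> 0" by simp
  have "cf_frac f 0 * cf_complete f 1 = 1"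
    unfolding One_nat_def cf_complete_Suc using nz by simp
  moreover have "cf_error f 1 = fls_of_zpoly (cf_partial f 1) * cf_frac f 0 - 1"
    by (simp add: cf_error_def cf_frac_def fls_of_zpoly_add fls_of_zpoly_mult algebra_simps)
  ultimately have "cf_error f 1 = - cf_frac f 0 * cf_frac f 1"
    unfolding cf_frac_def[of f 1] by (simp add: algebra_simps)
  with nz \<open>cf_error f 0 = cf_frac f 0\<close> show ?case by simp
next
  case (Suc k)
  have "degree (cf_partial f (Suc k)) > 0"
    using Suc degree_cf_partial_Suc by blast
  then have less: "degree (cf_denom f k) < degree (cf_denom f (Suc k))" using Suc by simp
  then have denom: "cf_denom f (Suc k) \<noteq> 0" by auto
  \<comment> \<open>The induction hypothesis writes this error as a product containing
    \<open>cf_frac f (Suc k)\<close>, so its non-vanishing carries over to that factor.\<close>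
  have err: "cf_error f (Suc k) \<noteq> 0" by (rule cf_error_nonzero[OF assms denom])
  then have frac: "cf_frac f (Suc k) \<noteq> 0" using Suc by auto
  have pos: "degree (cf_partial f (Suc (Suc k))) > 0" by (rule degree_cf_partial_Suc[OF frac])
  then have "cf_partial f (Suc (Suc k)) \<noteq> 0" by auto
  with denom have deg_mult: "degree (cf_partial f (Suc (Suc k)) * cf_denom f (Suc k))
      = degree (cf_partial f (Suc (Suc k))) + degree (cf_denom f (Suc k))"
    by (simp add: degree_mult_eq)
  have "degree (cf_denom f (Suc (Suc k)))
      = degree (cf_partial f (Suc (Suc k))) + degree (cf_denom f (Suc k))"
    unfolding cf_denom.simps using less deg_mult by (subst degree_add_eq_left) auto
  moreover have "cf_error f (Suc (Suc k)) = - cf_error f (Suc k) * cf_frac f (Suc (Suc k))"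
  proof -
    have "cf_frac f (Suc k) * cf_complete f (Suc (Suc k)) = 1"
      unfolding cf_complete_Suc using frac by simp
    moreover have "cf_error f (Suc k) * cf_complete f (Suc (Suc k))
        = - cf_error f k * (cf_frac f (Suc k) * cf_complete f (Suc (Suc k)))"
      using Suc by simp
    \<comment> \<open>With the earlier error written as a multiple of the later one, the recurrence
      for errors factors, and complete quotient minus partial quotient leaves the fractional
      part.\<close>
    ultimately have *: "cf_error f k = - cf_error f (Suc k) * cf_complete f (Suc (Suc k))"
      by simp
    have "cf_error f (Suc (Suc k))
        = fls_of_zpoly (cf_partial f (Suc (Suc k))) * cf_error f (Suc k) + cf_error f k"
      by (simp add: cf_error_def fls_of_zpoly_add fls_of_zpoly_mult algebra_simps)
    then show ?thesis
      unfolding * cf_frac_def[of f "Suc (Suc k)"] by (simp add: algebra_simps)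
  qed
  ultimately show ?case using frac denom by blast
qed

lemma cf_denom_nonzero:
  assumes "\<not> is_rational_function f"
  shows "cf_denom f k \<noteq> 0"
  using cf_step[OF assms, of k] by blast

lemma strict_mono_degree_cf_denom:
  assumes "\<not> is_rational_function f"
  shows "strict_mono (\<lambda>k. degree (cf_denom f k))"
  unfolding strict_mono_Suc_iff using cf_step[OF assms] degree_cf_partial_Suc(2) by force

text \<open>Up to sign the errors are products of fractional parts, so their orders add up exactly
  as the degrees of the partial quotients do. An order in \<open>X\<close> is a negated degree in
  \<open>z\<close>.\<close>

lemma fls_subdegree_cf_error:
  assumes "\<not> is_rational_function f"
  shows "fls_subdegree (cf_error f k) = int (degree (cf_denom f (Suc k)))"
proof (induction k)
  case 0
  have "cf_error f 0 = cf_frac f 0" by (simp add: cf_error_def cf_frac_def)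
  then show ?case using cf_step[OF assms, of 0] degree_cf_partial_Suc(1)[of f 0] by simp
next
  case (Suc k)
  have "cf_error f k \<noteq> 0" by (rule cf_error_nonzero[OF assms cf_denom_nonzero[OF assms]])
  moreover have "cf_frac f (Suc k) \<noteq> 0" using cf_step[OF assms, of "Suc k"] by blast
  ultimately have "fls_subdegree (cf_error f (Suc k))
      = fls_subdegree (cf_error f k) + fls_subdegree (cf_frac f (Suc k))"
    using cf_step[OF assms, of k] by simp
  then show ?case
    using Suc degree_cf_partial_Suc(1)[OF \<open>cf_frac f (Suc k) \<noteq> 0\<close>] cf_step[OF assms, of "Suc k"] by simp
qed

subsection \<open>Evaluation of Laurent series\<close>

lemma of_rat_complex_conv_real: "of_rat r = complex_of_real (of_rat r)"
  by (cases r) (simp add: of_rat_rat)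

lemma fls_subdegree_complex_fls [simp]: "fls_subdegree (complex_fls f) = fls_subdegree f"
proof (cases "f = 0")
  case True
  then have "complex_fls f = 0" by (intro fls_eqI) simp
  with True show ?thesis by simp
next
  case False
  then show ?thesis by (intro fls_subdegree_eqI) auto
qed

lemma complex_fls_add: "complex_fls (f + g) = complex_fls f + complex_fls g"
  by (intro fls_eqI) (simp add: of_rat_add)

lemma complex_fls_diff: "complex_fls (f - g) = complex_fls f - complex_fls g"
  by (intro fls_eqI) (simp add: of_rat_diff)

lemma complex_fls_mult: "complex_fls (f * g) = complex_fls f * complex_fls g"
  by (intro fls_eqI) (simp add: fls_times_nth(2) of_rat_sum of_rat_mult)

lemma complex_fls_compose_power:
  "d > 0 \<Longrightarrow> complex_fls (fls_compose_power f d) = fls_compose_power (complex_fls f) d"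
  by (intro fls_eqI) (simp add: fls_nth_compose_power)

lemma complex_fls_of_zpoly: "complex_fls (fls_of_zpoly P) = fls_of_zpoly (map_poly of_rat P)"
  by (intro fls_eqI) (simp add: fls_nth_fls_of_zpoly coeff_map_poly)

lemma fls_conv_radius_fls_of_zpoly [simp]: "fls_conv_radius (fls_of_zpoly P) = \<infinity>"
proof (induction P)
  case (pCons a P)
  then show ?case
    by (auto simp: fls_of_zpoly_pCons fls_X_inv_times_conv_shift top_ereal_def
             intro!: antisym[OF _ fls_conv_radius_add_ge[of \<infinity>]])
qed simp

lemma eval_fls_of_zpoly:
  assumes "x \<noteq> 0"
  shows "eval_fls (fls_of_zpoly P) (inverse x) = poly P x"
proof (induction P)
  case (pCons a P)
  have "eval_fls (fls_of_zpoly (pCons a P)) (inverse x)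
      = a + eval_fls (fls_shift 1 (fls_of_zpoly P)) (inverse x)"
    using assms by (simp add: fls_of_zpoly_pCons fls_X_inv_times_conv_shift eval_fls_add)
  with assms pCons show ?case by (simp add: eval_fls_shift power_int_minus mult.commute)
qed simp

text \<open>The function \<open>z \<mapsto> F(z^d)\<close> has the composed series as its Laurent
  expansion at 0. Inside the unit disc \<open>z^d\<close> is no larger than \<open>z\<close>, so the
  disc of convergence is not left.\<close>

lemma
  fixes F :: "complex fls"
  assumes "d > 0" "norm x < 1" "ereal (norm x) < fls_conv_radius F"
  shows eval_fls_compose_power:
      "x \<noteq> 0 \<Longrightarrow> eval_fls (fls_compose_power F d) x = eval_fls F (x ^ d)"
    and fls_conv_radius_compose_power:
      "ereal (norm x) < fls_conv_radius (fls_compose_power F d)"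
proof -
  define r where "r = min 1 (fls_conv_radius F)"
  have pow: "ereal (norm (z ^ d)) < fls_conv_radius F" if "ereal (norm z) < r" for z :: complex
  proof -
    have "norm z < 1" "ereal (norm z) < fls_conv_radius F"
      using that by (simp_all add: r_def one_ereal_def)
    moreover from this have "norm (z ^ d) \<le> norm z"
      using power_decreasing[of 1 d "norm z"] assms(1) by (simp add: norm_power)
    ultimately show ?thesis by (meson ereal_less_eq(3) le_less_trans)
  qed
  have "ereal 0 \<le> norm x" by simp
  then have pos: "fls_conv_radius F > 0"
    using assms(3) by (metis le_less_trans zero_ereal_def)
  have "(eval_fls F \<circ> (\<lambda>z. z ^ d)) has_laurent_expansion fls_compose_fps F (fps_X ^ d)"
    using assms(1) pos by (intro has_laurent_expansion_compose eval_fls_has_laurent_expansion)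
      (auto intro!: has_laurent_expansion_fps has_fps_expansion_fps_X_power)
  \<comment> \<open>The two notions of composition agree: split \<open>F\<close> into a power of
    \<open>X\<close> and a power series, and compose each factor.\<close>
  moreover have "fls_compose_fps F (fps_X ^ d) = fls_compose_power F d"
  proof -
    obtain G where F: "F = fls_shift (- fls_subdegree F) (fps_to_fls G)"
      using fls_as_fps[of F "- fls_subdegree F"] by auto
    have "fls_compose_fps F (fps_X ^ d)
        = fps_to_fls (fps_compose G (fps_X ^ d)) * (fls_X ^ d) powi fls_subdegree F"
      using assms(1) by (subst F) (simp add: fls_compose_fps_shift fps_to_fls_power)
    also have "(fls_X ^ d :: complex fls) powi fls_subdegree F
        = fls_X_intpow (int d * fls_subdegree F)"
      using fls_X_power_int[of "int d * fls_subdegree F"]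
      by (simp only: power_int_mult power_int_of_nat)
    also have "fps_to_fls (fps_compose G (fps_X ^ d)) * fls_X_intpow (int d * fls_subdegree F)
        = fls_shift (int d * - fls_subdegree F) (fls_compose_power (fps_to_fls G) d)"
      using assms(1) by (simp add: fls_compose_power_fps_to_fls fls_X_intpow_times_conv_shift)
    also have "\<dots> = fls_compose_power F d"
      using assms(1) by (subst (2) F) simp
    finally show ?thesis .
  qed
  ultimately have exp: "(\<lambda>z. eval_fls F (z ^ d)) has_laurent_expansion fls_compose_power F d"
    by (simp add: o_def)
  \<comment> \<open>Holomorphy on this punctured disc makes the expansion converge there and
    represent the function, which yields both claims.\<close>
  have hol: "(\<lambda>z. eval_fls F (z ^ d)) holomorphic_on eball 0 r - {0}"
    using pow by (intro holomorphic_intros) auto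
  have x: "ereal (norm x) < r" using assms by (simp add: r_def one_ereal_def)
  show "ereal (norm x) < fls_conv_radius (fls_compose_power F d)"
    using fls_conv_radius_ge[OF exp hol] x by (rule less_le_trans[rotated])
  show "eval_fls (fls_compose_power F d) x = eval_fls F (x ^ d)" if "x \<noteq> 0"
    using eval_fls_eqI[OF exp hol, of x] x that by auto
qed

text \<open>The condition \<open>x \<noteq> 0\<close> excludes the junk value
  \<open>inverse 0 = 0\<close>, which lies in every disc of positive radius.\<close>

definition converges_at :: "rat fls \<Rightarrow> real \<Rightarrow> bool" where
  "converges_at f x \<longleftrightarrow> x \<noteq> 0 \<and> ereal (norm (inverse x)) < fls_conv_radius (complex_fls f)"

lemma converges_at_iff: "converges_at f x \<longleftrightarrow> x \<noteq> 0 \<and> conv_rho f < ereal \<bar>x\<bar>"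
  using conv_rho_less_iff[of "\<bar>x\<bar>" f] by (auto simp: converges_at_def)

lemma of_real_fls_value':
  "converges_at f x \<Longrightarrow> of_real (fls_value f x) = eval_fls (complex_fls f) (inverse (of_real x))"
  using of_real_fls_value[of f x] by (simp add: converges_at_iff)

lemma converges_at_fls_of_zpoly [simp]: "converges_at (fls_of_zpoly P) x \<longleftrightarrow> x \<noteq> 0"
  by (simp add: converges_at_def complex_fls_of_zpoly)

lemma converges_at_add:
  "converges_at f x \<Longrightarrow> converges_at g x \<Longrightarrow> converges_at (f + g) x"
  by (auto simp: converges_at_def complex_fls_add intro: less_le_trans[OF _ fls_conv_radius_add])

lemma converges_at_diff:
  "converges_at f x \<Longrightarrow> converges_at g x \<Longrightarrow> converges_at (f - g) x"
  by (auto simp: converges_at_def complex_fls_diff intro: less_le_trans[OF _ fls_conv_radius_diff])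

lemma converges_at_mult:
  "converges_at f x \<Longrightarrow> converges_at g x \<Longrightarrow> converges_at (f * g) x"
  by (auto simp: converges_at_def complex_fls_mult intro: less_le_trans[OF _ fls_conv_radius_mult])

lemma fls_value_fls_of_zpoly:
  assumes "x \<noteq> 0"
  shows "fls_value (fls_of_zpoly P) x = poly (map_poly of_rat P) x"
proof -
  have "complex_of_real (fls_value (fls_of_zpoly P) x) = poly (map_poly of_rat P) (of_real x)"
    using assms by (simp add: of_real_fls_value' complex_fls_of_zpoly eval_fls_of_zpoly)
  also have "map_poly of_rat P = map_poly complex_of_real (map_poly of_rat P)"
    by (rule poly_eqI) (simp add: coeff_map_poly of_rat_complex_conv_real)
  also have "poly \<dots> (of_real x) = of_real (poly (map_poly of_rat P) x)"
    by (induction P) (auto simp: map_poly_pCons)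
  finally show ?thesis by (simp only: of_real_eq_iff)
qed

lemma fls_value_add:
  assumes "converges_at f x" "converges_at g x"
  shows "fls_value (f + g) x = fls_value f x + fls_value g x"
proof -
  have "complex_of_real (fls_value (f + g) x) = of_real (fls_value f x + fls_value g x)"
    using assms converges_at_add[OF assms] 
    by (simp add: of_real_fls_value' complex_fls_add eval_fls_add converges_at_def norm_inverse)
  then show ?thesis by (simp only: of_real_eq_iff)
qed

lemma fls_value_diff:
  assumes "converges_at f x" "converges_at g x"
  shows "fls_value (f - g) x = fls_value f x - fls_value g x"
proof -
  have "complex_of_real (fls_value (f - g) x) = of_real (fls_value f x - fls_value g x)"
    using assms converges_at_diff[OF assms] 
    by (simp add: of_real_fls_value' complex_fls_diff eval_fls_diff converges_at_def norm_inverse)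
  then show ?thesis by (simp only: of_real_eq_iff)
qed

lemma fls_value_mult:
  assumes "converges_at f x" "converges_at g x"
  shows "fls_value (f * g) x = fls_value f x * fls_value g x"
proof -
  have "complex_of_real (fls_value (f * g) x) = of_real (fls_value f x * fls_value g x)"
    using assms converges_at_mult[OF assms] 
    by (simp add: of_real_fls_value' complex_fls_mult eval_fls_mult converges_at_def norm_inverse)
  then show ?thesis by (simp only: of_real_eq_iff)
qed

text \<open>Since \<open>\<bar>x\<bar> > 1\<close>, the point \<open>x ^ d\<close> is at least as
  far out as \<open>x\<close> and hence also a point of convergence.\<close>

lemma
  assumes "converges_at f x" "\<bar>x\<bar> > 1" "d > 0"
  shows converges_at_compose_power: "converges_at (fls_compose_power f d) x"
    and fls_value_compose_power: "fls_value (fls_compose_power f d) x = fls_value f (x ^ d)"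
proof -
  have small: "norm (inverse (of_real x) :: complex) < 1"
    using assms by (simp add: norm_inverse inverse_less_1_iff)
  have rad: "ereal (norm (inverse (of_real x) :: complex)) < fls_conv_radius (complex_fls f)"
    and "x \<noteq> 0"
    using assms by (auto simp: converges_at_def norm_inverse)
  show conv: "converges_at (fls_compose_power f d) x"
    using fls_conv_radius_compose_power[OF assms(3) small rad] \<open>x \<noteq> 0\<close> assms(3)
    by (simp add: converges_at_def complex_fls_compose_power norm_inverse)
  have "\<bar>x\<bar> \<le> \<bar>x ^ d\<bar>"
    using assms power_increasing[of 1 d "\<bar>x\<bar>"] by (simp add: power_abs)
  then have conv': "converges_at f (x ^ d)"
    using assms unfolding converges_at_iff by (auto intro: less_le_trans)
  have "complex_of_real (fls_value (fls_compose_power f d) x) = of_real (fls_value f (x ^ d))"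
    using conv conv' eval_fls_compose_power[OF assms(3) small rad] \<open>x \<noteq> 0\<close> assms(3)
    by (simp add: of_real_fls_value' complex_fls_compose_power power_inverse)
  then show "fls_value (fls_compose_power f d) x = fls_value f (x ^ d)"
    by (simp only: of_real_eq_iff)
qed

text \<open>After the leading power of \<open>X\<close> is split off, a power series remains that is
  continuous, hence bounded, on the compact disc of radius \<open>1 / \<bar>x0\<bar>\<close>. So one
  constant serves all the points \<open>y t\<close> later.\<close>

lemma fls_value_bound:
  assumes "converges_at f x0"
  obtains c where "\<And>x. \<bar>x\<bar> \<ge> \<bar>x0\<bar> \<Longrightarrow> \<bar>fls_value f x\<bar> \<le> c * \<bar>x\<bar> powi (- fls_subdegree f)"
proof -
  define G where "G = fls_base_factor_to_fps (complex_fls f)"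
  define r where "r = norm (inverse x0)"
  have x0: "x0 \<noteq> 0" "ereal r < fps_conv_radius G"
    using assms by (simp_all add: converges_at_def fls_conv_radius_altdef r_def G_def)
  have "continuous_on (cball 0 r) (eval_fps G)"
    using x0 by (intro continuous_on_subset[OF continuous_on_eval_fps])
      (auto intro: le_less_trans[OF ereal_less_eq(3)[THEN iffD2]])
  then have "bounded (eval_fps G ` cball 0 r)"
    by (intro compact_imp_bounded compact_continuous_image) auto
  then obtain c where c: "\<And>z. norm z \<le> r \<Longrightarrow> norm (eval_fps G z) \<le> c"
    unfolding bounded_iff by (metis imageI mem_cball_0)
  show ?thesis
  proof (rule that)
    fix x :: real
    assume x: "\<bar>x\<bar> \<ge> \<bar>x0\<bar>"
    have "\<bar>fls_value f x\<bar> \<le> norm (eval_fls (complex_fls f) (of_real (inverse x)))"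
      unfolding fls_value_def by (rule abs_Re_le_cmod)
    also have "\<dots> = norm (eval_fps G (of_real (inverse x))) * \<bar>x\<bar> powi (- fls_subdegree f)"
      by (simp add: eval_fls_def G_def norm_mult norm_power_int norm_inverse power_int_minus
           power_int_inverse)
    also have "\<dots> \<le> c * \<bar>x\<bar> powi (- fls_subdegree f)"
      using x x0 by (intro mult_right_mono c) (auto simp: r_def norm_inverse le_imp_inverse_le)
    finally show "\<bar>fls_value f x\<bar> \<le> c * \<bar>x\<bar> powi (- fls_subdegree f)" .
  qed
qed

subsection \<open>Integer values of rational polynomials\<close>

definition int_value :: "rat poly \<Rightarrow> int \<Rightarrow> real" where
  "int_value P x = of_rat (poly P (of_int x))"

lemma int_value_altdef: "int_value P x = poly (map_poly of_rat P) (of_int x)"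
  unfolding int_value_def
  by (induction P) (simp_all add: map_poly_pCons of_rat_add of_rat_mult)

lemma int_value_diff: "int_value (P - Q) x = int_value P x - int_value Q x"
  and int_value_mult: "int_value (P * Q) x = int_value P x * int_value Q x"
  by (simp_all add: int_value_def of_rat_diff of_rat_mult)

text \<open>Multiplying up the denominators of the coefficients gives one denominator for all
  integer points.\<close>

lemma int_value_denominator:
  obtains D :: int where "D > 0" "\<And>x. of_int D * int_value P x \<in> \<int>"
proof -
  have "\<exists>D::int. D > 0 \<and> (\<forall>x. of_int D * int_value P x \<in> \<int>)"
  proof (induction P)
    case (pCons a P)
    then obtain D where D: "D > 0" "\<And>x. of_int D * int_value P x \<in> \<int>" by blast
    obtain m n :: int where a: "a = of_int m / of_int n" "n > 0"
      by (metis quotient_of_denom_pos' quotient_of_div prod.collapse)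
    have "of_int (n * D) * int_value (pCons a P) x \<in> \<int>" for x
    proof -
      have "of_int (n * D) * int_value (pCons a P) x
          = of_int (D * m) + of_int (n * x) * (of_int D * int_value P x)"
        using a by (simp add: int_value_def of_rat_add of_rat_mult of_rat_divide algebra_simps)
      also have "\<dots> \<in> \<int>" by (rule Ints_add[OF Ints_of_int Ints_mult[OF Ints_of_int D(2)]])
      finally show ?thesis .
    qed
    with a(2) D(1) show ?case by (intro exI[of _ "n * D"]) auto
  qed (auto simp: int_value_def intro: exI[of _ 1])
  with that show thesis by blast
qed

lemma poly_degree_bound:
  fixes P :: "real poly"
  obtains c where "c \<ge> 0" "\<And>x. \<bar>x\<bar> \<ge> 1 \<Longrightarrow> \<bar>poly P x\<bar> \<le> c * \<bar>x\<bar> ^ degree P"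
proof
  show "(\<Sum>i\<le>degree P. \<bar>coeff P i\<bar>) \<ge> 0" by (simp add: sum_nonneg)
  fix x :: real
  assume x: "\<bar>x\<bar> \<ge> 1"
  have "\<bar>poly P x\<bar> \<le> (\<Sum>i\<le>degree P. \<bar>coeff P i * x ^ i\<bar>)"
    unfolding poly_altdef by (rule sum_abs)
  also have "\<dots> \<le> (\<Sum>i\<le>degree P. \<bar>coeff P i\<bar> * \<bar>x\<bar> ^ degree P)"
    using x by (intro sum_mono) (auto simp: abs_mult power_abs intro!: mult_left_mono power_increasing)
  finally show "\<bar>poly P x\<bar> \<le> (\<Sum>i\<le>degree P. \<bar>coeff P i\<bar>) * \<bar>x\<bar> ^ degree P"
    by (simp add: sum_distrib_right)
qed

lemma int_value_degree_bound:
  obtains c where "c \<ge> 0" "\<And>x. \<bar>x\<bar> \<ge> 1 \<Longrightarrow> \<bar>int_value P x\<bar> \<le> c * \<bar>of_int x\<bar> ^ degree P"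
proof -
  have "degree (map_poly real_of_rat P) = degree P" by (simp add: degree_map_poly)
  then obtain c where "c \<ge> 0"
    and c: "\<And>x. \<bar>x\<bar> \<ge> 1 \<Longrightarrow> \<bar>poly (map_poly real_of_rat P) x\<bar> \<le> c * \<bar>x\<bar> ^ degree P"
    using poly_degree_bound[of "map_poly real_of_rat P"] by metis
  moreover have "\<bar>int_value P x\<bar> \<le> c * \<bar>of_int x\<bar> ^ degree P" if "\<bar>x\<bar> \<ge> 1" for x
    unfolding int_value_altdef using that by (intro c) linarith
  ultimately show thesis using that by blast
qed

text \<open>The constant is absorbed into extra powers of \<open>x\<close>, using
  \<open>\<bar>x\<bar> \<ge> 2\<close>. A bare power is wanted because a constant would accumulate
  in the products over \<open>i < t\<close>.\<close>

lemma int_value_power_bound: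
  obtains e where "\<And>x. \<bar>x\<bar> \<ge> 2 \<Longrightarrow> \<bar>r * int_value P x\<bar> \<le> \<bar>of_int x\<bar> ^ e"
proof -
  obtain c where c: "c \<ge> 0" "\<And>x. \<bar>x\<bar> \<ge> 1 \<Longrightarrow> \<bar>int_value P x\<bar> \<le> c * \<bar>of_int x\<bar> ^ degree P"
    using int_value_degree_bound[of P] by blast
  obtain s where s: "\<bar>r\<bar> * c \<le> 2 ^ s"
    using real_arch_pow[of 2 "\<bar>r\<bar> * c"] by (auto intro: less_imp_le)
  have "\<bar>r * int_value P x\<bar> \<le> \<bar>of_int x\<bar> ^ (s + degree P)" if x: "\<bar>x\<bar> \<ge> 2" for x
  proof -
    have "\<bar>r * int_value P x\<bar> \<le> \<bar>r\<bar> * (c * \<bar>of_int x\<bar> ^ degree P)"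
      unfolding abs_mult using x by (intro mult_left_mono c) auto
    also have "\<dots> \<le> 2 ^ s * \<bar>of_int x\<bar> ^ degree P"
      using s by (simp add: mult_right_mono flip: mult.assoc)
    also have "(2 :: real) ^ s \<le> \<bar>of_int x\<bar> ^ s"
      using x by (intro power_mono) linarith+
    finally show ?thesis by (simp add: power_add mult_right_mono)
  qed
  with that show thesis by blast
qed

text \<open>The exponents \<open>e * d^i\<close> with \<open>i < t\<close> sum to at most
  \<open>e * d^t\<close>, because doubling \<open>d^t\<close> does not exceed
  \<open>d^(t+1)\<close>.\<close>

lemma prod_lacunary_bound:
  fixes u :: "nat \<Rightarrow> real"
  assumes "\<beta> \<ge> 1" "d \<ge> 2" "\<And>i. \<bar>u i\<bar> \<le> \<beta> ^ (e * d ^ i)"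
  shows "\<bar>\<Prod>i<t. u i\<bar> \<le> \<beta> ^ (e * d ^ t)"
proof (induction t)
  case (Suc t)
  have "\<bar>\<Prod>i<Suc t. u i\<bar> \<le> \<beta> ^ (e * d ^ t) * \<beta> ^ (e * d ^ t)"
    using Suc assms by (simp add: abs_mult mult_mono)
  also have "\<dots> \<le> \<beta> ^ (e * d ^ Suc t)"
    using assms by (auto simp flip: power_add mult_2 intro!: power_increasing)
  finally show ?case .
qed (use assms in simp)

text \<open>An injective sequence meets the finitely many roots only finitely often.\<close>

lemma eventually_int_value_nonzero:
  assumes "P \<noteq> 0" "inj y"
  shows "\<forall>\<^sub>F t in sequentially. int_value P (y t) \<noteq> 0"
proof -
  have "finite {x. poly P x = 0}" using assms(1) by (rule poly_roots_finite)
  moreover have "inj (\<lambda>t. rat_of_int (y t))" using assms(2) by (simp add: inj_def)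
  ultimately have "finite ((\<lambda>t. rat_of_int (y t)) -` {x. poly P x = 0})" by (rule finite_vimageI)
  then show ?thesis
    unfolding cofinite_eq_sequentially[symmetric] eventually_cofinite
    by (simp add: int_value_def vimage_def)
qed

subsection \<open>Values of Mahler functions\<close>

locale mahler_value =
  fixes d :: nat and A B C :: "rat poly" and f :: "rat fls" and b :: int
  assumes d: "d \<ge> 2"
    and B_nz: "B \<noteq> 0"
    and equation: "f = (fls_of_zpoly A * fls_compose_power f d + fls_of_zpoly C) / fls_of_zpoly B"
    and irrational: "\<not> is_rational_function f"
    and b: "\<bar>b\<bar> \<ge> 2"
    and converges: "converges_at f (of_int b)"
    and nonvanishing: "\<And>t. poly A (of_int (b ^ (d ^ t))) * poly B (of_int (b ^ (d ^ t))) \<noteq> 0"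
begin

definition y :: "nat \<Rightarrow> int" where "y t = b ^ (d ^ t)"

abbreviation \<beta> :: real where "\<beta> \<equiv> of_int \<bar>b\<bar>"

lemma \<beta>: "\<beta> \<ge> 2"
  using b by linarith

lemma abs_y: "\<bar>real_of_int (y t)\<bar> = \<beta> ^ (d ^ t)"
  by (simp add: y_def power_abs)

lemma y_0 [simp]: "y 0 = b"
  by (simp add: y_def)

lemma y_ge: "\<bar>real_of_int (y t)\<bar> \<ge> \<beta>" "\<bar>y t\<bar> \<ge> 2"
proof -
  show "\<bar>real_of_int (y t)\<bar> \<ge> \<beta>"
    unfolding abs_y using power_increasing[of 1 "d ^ t" \<beta>] \<beta> d by simp
  with b show "\<bar>y t\<bar> \<ge> 2" by linarith
qed

lemma inj_y: "inj y"
proof (rule injI)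
  fix s t assume "y s = y t"
  then have "\<beta> ^ (d ^ s) = \<beta> ^ (d ^ t)" by (metis abs_y)
  then have "d ^ s = d ^ t" using \<beta> by simp
  then show "s = t" using d by simp
qed

lemma y_Suc: "real_of_int (y (Suc t)) = real_of_int (y t) ^ d"
  by (simp add: y_def mult.commute flip: power_mult)

lemma converges_y: "converges_at f (of_int (y t))"
  using converges y_ge[of t] b unfolding converges_at_iff
  by (auto intro: less_le_trans)

lemma functional_equation:
  "int_value B (y t) * fls_value f (of_int (y t))
     = int_value A (y t) * fls_value f (of_int (y (Suc t))) + int_value C (y t)"
proof -
  let ?x = "real_of_int (y t)"
  have x: "?x \<noteq> 0" "\<bar>?x\<bar> > 1" using y_ge[of t] \<beta> by auto
  \<comment> \<open>The denominator is cleared first, so that evaluation only has to respect sums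
    and products.\<close>
  have "fls_of_zpoly B * f = fls_of_zpoly A * fls_compose_power f d + fls_of_zpoly C"
    using B_nz by (subst equation) simp
  then have "fls_value (fls_of_zpoly B * f) ?x
      = fls_value (fls_of_zpoly A * fls_compose_power f d + fls_of_zpoly C) ?x" by simp
  moreover have "converges_at (fls_compose_power f d) ?x"
    using converges_y x d by (intro converges_at_compose_power) auto
  moreover have "fls_value (fls_compose_power f d) ?x = fls_value f (of_int (y (Suc t)))"
    unfolding y_Suc using converges_y x d by (intro fls_value_compose_power) auto
  ultimately show ?thesis
    using converges_y[of t] x
    by (simp add: fls_value_add fls_value_mult converges_at_mult fls_value_fls_of_zpoly
          flip: int_value_altdef)
qed

section \<open>Common denominators and iterates of the functional equation\<close>

definition D :: int where
  "D = (SOME D. D > 0 \<and> (\<forall>P\<in>{A, B, C}. \<forall>x. of_int D * int_value P x \<in> \<int>))"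

lemma D: "D > 0" "P \<in> {A, B, C} \<Longrightarrow> of_int D * int_value P x \<in> \<int>"
proof -
  obtain DA :: int where DA: "DA > 0" "\<And>x. of_int DA * int_value A x \<in> \<int>"
    using int_value_denominator[of A] by blast
  obtain DB :: int where DB: "DB > 0" "\<And>x. of_int DB * int_value B x \<in> \<int>"
    using int_value_denominator[of B] by blast
  obtain DC :: int where DC: "DC > 0" "\<And>x. of_int DC * int_value C x \<in> \<int>"
    using int_value_denominator[of C] by blast
  have "of_int (DA * DB * DC) * int_value A x \<in> \<int>"
       "of_int (DA * DB * DC) * int_value B x \<in> \<int>"
       "of_int (DA * DB * DC) * int_value C x \<in> \<int>" for x
    using Ints_mult[OF Ints_of_int[of "DB * DC"] DA(2)[of x]]
          Ints_mult[OF Ints_of_int[of "DA * DC"] DB(2)[of x]]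
          Ints_mult[OF Ints_of_int[of "DA * DB"] DC(2)[of x]]
    by (simp_all add: mult_ac)
  then have "\<exists>D::int. D > 0 \<and> (\<forall>P\<in>{A, B, C}. \<forall>x. of_int D * int_value P x \<in> \<int>)"
    using DA(1) DB(1) DC(1) by (intro exI[of _ "DA * DB * DC"]) auto
  then have "D > 0 \<and> (\<forall>P\<in>{A, B, C}. \<forall>x. of_int D * int_value P x \<in> \<int>)"
    unfolding D_def by (rule someI_ex)
  then show "D > 0" "P \<in> {A, B, C} \<Longrightarrow> of_int D * int_value P x \<in> \<int>" by blast+
qed

text \<open>One factor \<open>D\<close> per step makes the product an integer; the resulting
  \<open>D^t\<close> is covered by \<open>At_Bt_bound\<close>.\<close>

definition At :: "nat \<Rightarrow> real" where "At t = (\<Prod>i<t. of_int D * int_value A (y i))"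

definition Bt :: "nat \<Rightarrow> real" where "Bt t = (\<Prod>i<t. of_int D * int_value B (y i))"

primrec Ct :: "nat \<Rightarrow> real" where
  "Ct 0 = 0"
| "Ct (Suc t) = Ct t * (of_int D * int_value B (y t)) + At t * (of_int D * int_value C (y t))"

lemma iterated_equation:
  "Bt t * fls_value f (of_int b) = At t * fls_value f (of_int (y t)) + Ct t"
proof (induction t)
  case (Suc t)
  have "Bt (Suc t) * fls_value f (of_int b)
      = of_int D * int_value B (y t) * (Bt t * fls_value f (of_int b))"
    by (simp add: Bt_def)
  also have "\<dots> = of_int D * At t * (int_value B (y t) * fls_value f (of_int (y t)))
      + of_int D * int_value B (y t) * Ct t"
    unfolding Suc by (simp add: algebra_simps)
  also have "\<dots> = At (Suc t) * fls_value f (of_int (y (Suc t))) + Ct (Suc t)"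
    unfolding functional_equation by (simp add: At_def algebra_simps)
  finally show ?case .
qed (simp add: At_def Bt_def)

lemma At_Ints: "At t \<in> \<int>" and Bt_Ints: "Bt t \<in> \<int>"
  unfolding At_def Bt_def by (auto intro!: Ints_prod D)

lemma Ct_Ints: "Ct t \<in> \<int>"
proof (induction t)
  case (Suc t)
  then show ?case unfolding Ct.simps by (intro Ints_add Ints_mult At_Ints D) auto
qed simp

lemma At_nonzero: "At t \<noteq> 0" and Bt_nonzero: "Bt t \<noteq> 0"
  using nonvanishing D(1) by (auto simp: At_def Bt_def int_value_def y_def)

text \<open>\<open>D\<close> and all constants disappear into the exponent of each factor, and the
  product is lacunary. The resulting \<open>e\<close> is independent of \<open>k\<close>, as the
  uniform loss \<open>a\<close> requires.\<close>

lemma At_Bt_bound: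
  obtains e where "\<And>t. \<bar>At t\<bar> \<le> \<beta> ^ (e * d ^ t)" "\<And>t. \<bar>Bt t\<bar> \<le> \<beta> ^ (e * d ^ t)"
proof -
  obtain eA where eA: "\<And>x. \<bar>x\<bar> \<ge> 2 \<Longrightarrow> \<bar>of_int D * int_value A x\<bar> \<le> \<bar>of_int x\<bar> ^ eA"
    using int_value_power_bound[of "of_int D" A] by blast
  obtain eB where eB: "\<And>x. \<bar>x\<bar> \<ge> 2 \<Longrightarrow> \<bar>of_int D * int_value B x\<bar> \<le> \<bar>of_int x\<bar> ^ eB"
    using int_value_power_bound[of "of_int D" B] by blast
  have mono: "\<bar>real_of_int (y i)\<bar> ^ e \<le> \<beta> ^ ((eA + eB) * d ^ i)" if "e \<le> eA + eB" for e i
    unfolding abs_y power_mult[symmetric] using \<beta> that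
    by (intro power_increasing) (auto simp: mult.commute)
  have "\<bar>of_int D * int_value A (y i)\<bar> \<le> \<beta> ^ ((eA + eB) * d ^ i)"
       "\<bar>of_int D * int_value B (y i)\<bar> \<le> \<beta> ^ ((eA + eB) * d ^ i)" for i
    using eA[OF y_ge(2)[of i]] eB[OF y_ge(2)[of i]] mono[of eA i] mono[of eB i] by linarith+
  then show thesis
    using \<beta> d that[of "eA + eB"] prod_lacunary_bound[of \<beta> d] unfolding At_def Bt_def by simp
qed

text \<open>This denominator depends on \<open>k\<close> but not on \<open>t\<close>, so it is
  negligible as \<open>t\<close> grows.\<close>

definition conv_denom :: "nat \<Rightarrow> int" where
  "conv_denom k = (SOME E. E > 0 \<and>
     (\<forall>x. of_int E * int_value (cf_num f k) x \<in> \<int> \<and> of_int E * int_value (cf_denom f k) x \<in> \<int>))"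

lemma conv_denom: "conv_denom k > 0"
    "of_int (conv_denom k) * int_value (cf_num f k) x \<in> \<int>"
    "of_int (conv_denom k) * int_value (cf_denom f k) x \<in> \<int>"
proof -
  obtain E :: int where E: "E > 0" "\<And>x. of_int E * int_value (cf_num f k) x \<in> \<int>"
    using int_value_denominator[of "cf_num f k"] by blast
  obtain F :: int where F: "F > 0" "\<And>x. of_int F * int_value (cf_denom f k) x \<in> \<int>"
    using int_value_denominator[of "cf_denom f k"] by blast
  have "of_int (E * F) * int_value (cf_num f k) x \<in> \<int>"
       "of_int (E * F) * int_value (cf_denom f k) x \<in> \<int>" for x
    using Ints_mult[OF Ints_of_int[of F] E(2)[of x]] Ints_mult[OF Ints_of_int[of E] F(2)[of x]]
    by (simp_all add: mult_ac)
  with E(1) F(1) have "\<exists>E::int. E > 0 \<and>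
     (\<forall>x. of_int E * int_value (cf_num f k) x \<in> \<int> \<and> of_int E * int_value (cf_denom f k) x \<in> \<int>)"
    by (intro exI[of _ "E * F"]) auto
  then have "conv_denom k > 0 \<and> (\<forall>x. of_int (conv_denom k) * int_value (cf_num f k) x \<in> \<int> \<and>
      of_int (conv_denom k) * int_value (cf_denom f k) x \<in> \<int>)"
    unfolding conv_denom_def by (rule someI_ex)
  then show "conv_denom k > 0" "of_int (conv_denom k) * int_value (cf_num f k) x \<in> \<int>"
    "of_int (conv_denom k) * int_value (cf_denom f k) x \<in> \<int>" by blast+
qed

text \<open>
  The floors are exact (\<open>of_int_P\<close>, \<open>of_int_Q\<close>): \<open>At\<close>, \<open>Bt\<close>, \<open>Ct\<close> and \<open>conv_denom\<close>
  carry all denominators.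
\<close>

definition P :: "nat \<Rightarrow> nat \<Rightarrow> int" where
  "P k t = \<lfloor>of_int (conv_denom k)
     * (At t * int_value (cf_num f k) (y t) + Ct t * int_value (cf_denom f k) (y t))\<rfloor>"

definition Q :: "nat \<Rightarrow> nat \<Rightarrow> int" where
  "Q k t = \<lfloor>of_int (conv_denom k) * (Bt t * int_value (cf_denom f k) (y t))\<rfloor>"

lemma of_int_P: "of_int (P k t) = of_int (conv_denom k)
     * (At t * int_value (cf_num f k) (y t) + Ct t * int_value (cf_denom f k) (y t))"
proof -
  have "At t * (of_int (conv_denom k) * int_value (cf_num f k) (y t))
      + Ct t * (of_int (conv_denom k) * int_value (cf_denom f k) (y t)) \<in> \<int>"
    by (intro Ints_add Ints_mult At_Ints Ct_Ints conv_denom)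
  then show ?thesis unfolding P_def by (intro of_int_floor) (simp add: algebra_simps)
qed

lemma of_int_Q: "of_int (Q k t) = of_int (conv_denom k) * (Bt t * int_value (cf_denom f k) (y t))"
proof -
  have "Bt t * (of_int (conv_denom k) * int_value (cf_denom f k) (y t)) \<in> \<int>"
    by (intro Ints_mult Bt_Ints conv_denom)
  then show ?thesis unfolding Q_def by (intro of_int_floor) (simp add: algebra_simps)
qed

text \<open>The iterated equation replaces \<open>Bt t * f(b)\<close>; the terms with
  \<open>Ct t\<close> cancel, and the error of the convergent at \<open>y t\<close> remains.\<close>

lemma linear_form_eq:
  "of_int (Q k t) * fls_value f (of_int b) - of_int (P k t)
     = of_int (conv_denom k) * At t * fls_value (cf_error f k) (of_int (y t))"
proof -
  have "of_int (y t) \<noteq> (0 :: real)" using y_ge[of t] \<beta> by auto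
  then have err: "fls_value (cf_error f k) (of_int (y t))
      = int_value (cf_denom f k) (y t) * fls_value f (of_int (y t)) - int_value (cf_num f k) (y t)"
    using converges_y[of t] unfolding cf_error_def
    by (simp add: fls_value_diff fls_value_mult converges_at_mult fls_value_fls_of_zpoly
          flip: int_value_altdef)
  have form: "of_int (Q k t) * fls_value f (of_int b)
      = of_int (conv_denom k) * int_value (cf_denom f k) (y t) * (Bt t * fls_value f (of_int b))"
    by (simp add: of_int_Q)
  show ?thesis
    unfolding err form iterated_equation of_int_P by (simp add: algebra_simps)
qed

text \<open>Constants depending on \<open>k\<close> are absorbed at the cost of one more
  \<open>d^t\<close> in the exponent.\<close>

lemma eventually_le_lacunary: "\<forall>\<^sub>F t in sequentially. K \<le> \<beta> powr (real d ^ t)"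
proof -
  have "(\<lambda>t. \<beta> powr (- 1 * real d ^ t)) \<longlonglongrightarrow> 0"
    using \<beta> d by (intro tendsto_powr_neg_power) auto
  then have "\<forall>\<^sub>F t in sequentially. \<beta> powr (- 1 * real d ^ t) < 1 / (\<bar>K\<bar> + 1)"
    by (rule order_tendstoD) auto
  then show ?thesis
  proof eventually_elim
    case (elim t)
    then have "\<bar>K\<bar> + 1 < \<beta> powr (real d ^ t)"
      using b by (simp add: powr_minus field_simps)
    then show ?case by linarith
  qed
qed

lemma power_lacunary_eq: "\<beta> ^ (e * d ^ t) = \<beta> powr (real e * real d ^ t)"
  using \<beta> by (simp flip: powr_realpow)

lemma irrationality_exponent_value:
  "irrationality_exponent (fls_value f (of_int b)) =
     1 + limsup (\<lambda>k. ereal (real (degree (cf_denom f (Suc k))) / real (degree (cf_denom f k))))"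
proof -
  obtain e where At_le: "\<And>t. \<bar>At t\<bar> \<le> \<beta> ^ (e * d ^ t)" and Bt_le: "\<And>t. \<bar>Bt t\<bar> \<le> \<beta> ^ (e * d ^ t)"
    by (rule At_Bt_bound) blast
  \<comment> \<open>In the loss \<open>real e + 1\<close>, \<open>e\<close> bounds \<open>At\<close>
    and \<open>Bt\<close>, and 1 absorbs the constants that depend on \<open>k\<close>.\<close>
  interpret mahler_approximations "\<lambda>k. degree (cf_denom f k)" P Q d "fls_value f (of_int b)" \<beta>
    "real e + 1"
  proof
    show "strict_mono (\<lambda>k. degree (cf_denom f k))"
      using irrational by (rule strict_mono_degree_cf_denom)
    show "d \<ge> 2" "\<beta> > 1" "real e + 1 \<ge> 0" using d \<beta> by auto
  next
    fix k
    obtain c where c: "c \<ge> 0" "\<And>x. \<bar>x\<bar> \<ge> 1 \<Longrightarrow>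
        \<bar>int_value (cf_denom f k) x\<bar> \<le> c * \<bar>of_int x\<bar> ^ degree (cf_denom f k)"
      using int_value_degree_bound[of "cf_denom f k"] by blast
    show "\<forall>\<^sub>F t in sequentially. \<bar>real_of_int (Q k t)\<bar>
        \<le> \<beta> powr ((real e + 1 + real (degree (cf_denom f k))) * real d ^ t)"
      using eventually_le_lacunary[of "of_int (conv_denom k) * c"]
    proof eventually_elim
      case (elim t)
      have "\<bar>real_of_int (Q k t)\<bar>
          = of_int (conv_denom k) * (\<bar>Bt t\<bar> * \<bar>int_value (cf_denom f k) (y t)\<bar>)"
        using conv_denom(1)[of k] by (simp add: of_int_Q abs_mult)
      also have "\<dots> \<le> of_int (conv_denom k)
          * (\<beta> ^ (e * d ^ t) * (c * \<bar>of_int (y t)\<bar> ^ degree (cf_denom f k)))"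
        using conv_denom(1)[of k] y_ge[of t]
        by (intro mult_left_mono mult_mono Bt_le c) auto
      also have "\<dots> = of_int (conv_denom k) * c
          * (\<beta> ^ (e * d ^ t) * \<beta> ^ (degree (cf_denom f k) * d ^ t))"
        unfolding abs_y by (simp add: mult.commute flip: power_mult)
      also have "\<dots> \<le> \<beta> powr (real d ^ t)
          * (\<beta> ^ (e * d ^ t) * \<beta> ^ (degree (cf_denom f k) * d ^ t))"
        using elim by (intro mult_right_mono) auto
      also have "\<dots> = \<beta> powr ((real e + 1 + real (degree (cf_denom f k))) * real d ^ t)"
        unfolding power_lacunary_eq by (simp add: algebra_simps flip: powr_add)
      finally show ?case .
    qed
  next
    fix k
    have "converges_at (cf_error f k) (of_int b)"
      unfolding cf_error_def using converges b
      by (intro converges_at_diff converges_at_mult) auto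
    then obtain c where c: "\<And>x. \<bar>x\<bar> \<ge> \<bar>real_of_int b\<bar> \<Longrightarrow>
        \<bar>fls_value (cf_error f k) x\<bar> \<le> c * \<bar>x\<bar> powi (- fls_subdegree (cf_error f k))"
      using fls_value_bound by blast
    show "\<forall>\<^sub>F t in sequentially. \<bar>of_int (Q k t) * fls_value f (of_int b) - of_int (P k t)\<bar>
        \<le> \<beta> powr ((real e + 1 - real (degree (cf_denom f (Suc k)))) * real d ^ t)"
      using eventually_le_lacunary[of "of_int (conv_denom k) * c"]
    proof eventually_elim
      case (elim t)
      let ?n = "degree (cf_denom f (Suc k))"
      \<comment> \<open>The order of the error in \<open>X\<close> is the next degree, and
        \<open>\<bar>y t\<bar>\<close> is \<open>\<beta> ^ (d ^ t)\<close>.\<close>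
      have powi: "\<bar>real_of_int (y t)\<bar> powi (- fls_subdegree (cf_error f k))
          = \<beta> powr (- (real ?n * real d ^ t))"
        unfolding abs_y fls_subdegree_cf_error[OF irrational] power_int_minus power_int_of_nat
          power_mult[symmetric] using \<beta>
        by (simp add: powr_minus mult.commute flip: powr_realpow)
      have "\<bar>of_int (Q k t) * fls_value f (of_int b) - of_int (P k t)\<bar>
          = of_int (conv_denom k) * (\<bar>At t\<bar> * \<bar>fls_value (cf_error f k) (of_int (y t))\<bar>)"
        using conv_denom(1)[of k] unfolding linear_form_eq by (simp add: abs_mult)
      also have "\<dots> \<le> of_int (conv_denom k)
          * (\<beta> ^ (e * d ^ t) * (c * \<beta> powr (- (real ?n * real d ^ t))))"
        unfolding powi[symmetric] using conv_denom(1)[of k] y_ge[of t]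
        by (intro mult_left_mono mult_mono At_le c) auto
      also have "\<dots> = of_int (conv_denom k) * c
          * (\<beta> ^ (e * d ^ t) * \<beta> powr (- (real ?n * real d ^ t)))"
        by simp
      also have "\<dots> \<le> \<beta> powr (real d ^ t) * (\<beta> ^ (e * d ^ t) * \<beta> powr (- (real ?n * real d ^ t)))"
        using elim by (intro mult_right_mono) auto
      also have "\<dots> = \<beta> powr ((real e + 1 - real ?n) * real d ^ t)"
        unfolding power_lacunary_eq by (simp add: algebra_simps flip: powr_add)
      finally show ?case .
    qed
  next
    fix k
    show "\<forall>\<^sub>F t in sequentially. Q k t \<noteq> 0"
      using eventually_int_value_nonzero[OF cf_denom_nonzero[OF irrational, of k] inj_y]
    proof eventually_elim
      case (elim t)
      then have "real_of_int (Q k t) \<noteq> 0"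
        using conv_denom(1)[of k] Bt_nonzero unfolding of_int_Q by simp
      then show ?case by simp
    qed
    have "P k t * Q (Suc k) t \<noteq> P (Suc k) t * Q k t" for t
    proof
      assume "P k t * Q (Suc k) t = P (Suc k) t * Q k t"
      then have "real_of_int (P (Suc k) t) * of_int (Q k t)
          - of_int (P k t) * of_int (Q (Suc k) t) = 0"
        by (simp flip: of_int_mult)
      \<comment> \<open>The terms with \<open>Ct t\<close> cancel in the cross determinant. What
        remains is that of the convergents, a sign, times non-zero factors, so independence holds
        for every \<open>t\<close>.\<close>
      also have "real_of_int (P (Suc k) t) * of_int (Q k t) - of_int (P k t) * of_int (Q (Suc k) t)
          = of_int (conv_denom k) * of_int (conv_denom (Suc k)) * At t * Bt t
            * int_value (cf_num f (Suc k) * cf_denom f k - cf_num f k * cf_denom f (Suc k)) (y t)"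
        unfolding of_int_P of_int_Q int_value_diff int_value_mult by (simp only: algebra_simps)
      finally show False
        using conv_denom(1)[of k] conv_denom(1)[of "Suc k"] At_nonzero Bt_nonzero
        by (simp add: cf_num_denom_det int_value_def)
    qed
    then show "\<forall>\<^sub>F t in sequentially. P k t * Q (Suc k) t \<noteq> P (Suc k) t * Q k t" by simp
  qed
  show ?thesis by (rule irrationality_exponent_eq)
qed

end

theorem theorem3p13:
  fixes d :: nat and A B C :: "rat poly" and f :: "rat fls" and b :: int
  assumes "d \<ge> 2"
    and "A \<noteq> 0" and "B \<noteq> 0" and "C \<noteq> 0"
    and "f = (fls_of_zpoly A * fls_compose_power f d + fls_of_zpoly C) / fls_of_zpoly B"
    and "\<not> is_rational_function f"
    and "\<bar>b\<bar> \<ge> 2"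
    and "ereal (of_int \<bar>b\<bar>) > conv_rho f"
    and "\<And>t :: nat. poly A (of_int (b ^ (d ^ t))) * poly B (of_int (b ^ (d ^ t))) \<noteq> 0"
  shows "irrationality_exponent (fls_value f (of_int b)) =
           1 + limsup (\<lambda>k. ereal (real (degree (cf_denom f (Suc k))) / real (degree (cf_denom f k))))"
proof -
  interpret mahler_value d A B C f b
    by unfold_locales (use assms in \<open>auto simp: converges_at_iff\<close>)
  show ?thesis by (rule irrationality_exponent_value)
qed

end
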